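(* Suppose that the distributional assumptions (i)–(iii) of the context hold, with constants $a,s,C>0$. Let $N_0,N_1\in\mathbb N_+$, set $N:=N_0+N_1$, and use the first $N_0$ observations as the reference block and the remaining $N_1$ observations as the averaging block. Fix $\varepsilon\in(0,1)$ and $\delta\in(0,1)$ such that $\varepsilon/2\le\operatorname{diam}(X)$. Set $\beta:=\varepsilon/2$ and $q_\varepsilon:=\lceil\varepsilon^{-2}\rceil$, and assume that $$N_0\ \ge\ \frac{1}{a(\varepsilon/8)^s}\log\Big(\frac{4\,\mathcal N(X,\rho,\varepsilon/8)}{\delta}\Big),\qquad N_1\ \ge\ \frac{1}{a(\varepsilon/2)^s}\max\Big\{2q_\varepsilon,\ 8\log\Big(\frac{4N_0}{\delta}\Big)\Big\}.$$ For every fixed $1$-Lipschitz function $f:(X,\rho)\to\mathbb R$, let $\hat f:=\hat f^{(\beta,q_\varepsilon,1)}_{\mathbb D_N}$ be the estimator defined in the context (with $q=q_\varepsilon$, $L=1$), built from the dataset $\mathbb D_N=((X_n,Y_n))_{n=1}^N$, $Y_n=f(X_n)+\varepsilon_n$. Then: (i) for every realization of $\mathbb D_N$, the map $\hat f:X\to\mathbb R$ is $1$-Lipschitz; (ii) with respect to the joint law $\mu^{\otimes N}=(\mu_X\otimes\nu)^{\otimes N}$, $$\mathbb P\Big(\|\hat f-f\|_\infty\le\varepsilon\Big(1+\sqrt{C\log(4N_0/\delta)}\Big)\Big)\ge 1-\delta .$$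
   Context: Notation: $[n]_+=\{1,\dots,n\}$; $\|h\|_\infty=\sup_{x\in X}|h(x)|$; $B_\rho(x,r)=\{y:\rho(x,y)<r\}$; $\mathcal N(X,\rho,r)$ is the smallest cardinality of a set $A\subseteq X$ with $X\subseteq\bigcup_{x\in A}B_\rho(x,r)$. Distributional assumptions. $(X,\rho)$ is a (non-empty) compact metric space, $\mu$ is a Borel probability measure on $X\times\mathbb R$ with marginals $\mu_X$ on $X$ and $\nu$ on $\mathbb R$, and $((X_n,\varepsilon_n))_{n\in\mathbb N_+}$ is an i.i.d. sequence with common law $\mu$. Assume: (i) there are constants $a>0$, $s>0$ such that $\operatorname{supp}(\mu_X)=X$ and $\mu_X(B_\rho(x,r))\ge a r^s$ for every $x\in X$ and every $0<r\le\operatorname{diam}(X)$; (ii) $\nu$ is integrable and centred ($\int|t|\,\nu(dt)<\infty$, $\int t\,\nu(dt)=0$), and there is $C>0$ such that $\nu$ satisfies the log-Sobolev inequality $$\int g^2\log(g^2)\,d\nu-\Big(\int g^2\,d\nu\Big)\log\Big(\int g^2\,d\nu\Big)\le C\int|\nabla g|^2\,d\nu$$ for every locally Lipschitz $g:\mathbb R\to\mathbb R$ for which both sides are finite, where $0\log 0:=0$ and $|\nabla g|(x)=\limsup_{y\to x}|g(x)-g(y)|/|x-y|$; (iii) design and noise are independent: $\mu=\mu_X\otimes\nu$. Estimator. Given $\mathbb D_N=((X_n,Y_n))_{n=1}^N$ with $N=N_0+N_1$, $\beta\ge 0$, $q\in[N_1]_+$ and $L>0$, set for $i\in[N_1]_+$,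 $k\in[N_0]_+$ $$H_{ik}:=\mathbf 1_{\{\rho(X_{N_0+i},X_k)\le\beta\}},\qquad G_{ik}:=\frac1q\,\mathbf 1_{\{\sum_{l=1}^{N_1}H_{lk}\ge q\}}\,H_{ik}\,\mathbf 1_{\{\sum_{l=1}^{i}H_{lk}\le q\}},\qquad V_k:=\sum_{i=1}^{N_1}Y_{N_0+i}\,G_{ik},$$ and define, for $x\in X$, $$\hat f^{(\beta,q,L)}_{\mathbb D_N}(x):=\tfrac12\Big(\min_{k\in[N_0]_+}\big(V_k+L\rho(x,X_k)\big)+\max_{k\in[N_0]_+}\big(V_k-L\rho(x,X_k)\big)\Big).$$ *)

theory Defs
  imports "HOL-Probability.Probability"
begin

text \<open>The compact metric space is rendered as a type of class \<open>metric_space\<close> whose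
  universe is compact; its metric is \<^const>\<open>dist\<close>.\<close>

definition measure_support :: "'a::topological_space measure \<Rightarrow> 'a set" where
  "measure_support M = {x. \<forall>U. open U \<longrightarrow> x \<in> U \<longrightarrow> emeasure M U > 0}"

text \<open>Only finite covers are considered, since \<^const>\<open>card\<close> is \<open>0\<close> on infinite sets; on a
  compact set (and for \<open>r > 0\<close>) a finite cover exists.\<close>

definition covering_number :: "'a::metric_space set \<Rightarrow> real \<Rightarrow> nat" where
  "covering_number S r =
     Inf {card A | A. finite A \<and> A \<subseteq> S \<and> S \<subseteq> (\<Union>x\<in>A. ball x r)}"

definition sup_norm :: "('a \<Rightarrow> real) \<Rightarrow> real" where
  "sup_norm h = (SUP x. \<bar>h x\<bar>)"

definition locally_lipschitz :: "(real \<Rightarrow> real) \<Rightarrow> bool" where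
  "locally_lipschitz g \<longleftrightarrow> (\<forall>x. \<exists>r>0. \<exists>K. K-lipschitz_on (ball x r) g)"

text \<open>The upper limit is taken in the extended reals; it is finite whenever \<open>g\<close> is locally
  Lipschitz.\<close>

definition local_slope :: "(real \<Rightarrow> real) \<Rightarrow> real \<Rightarrow> real" where
  "local_slope g x = real_of_ereal (Limsup (at x) (\<lambda>y. ereal (\<bar>g x - g y\<bar> / \<bar>x - y\<bar>)))"

text \<open>The convention \<open>0 log 0 = 0\<close> holds automatically. The integrability premises say that
  both sides of the inequality are finite.\<close>

definition log_sobolev :: "real \<Rightarrow> real measure \<Rightarrow> bool" where
  "log_sobolev C M \<longleftrightarrow>
     (\<forall>g. locally_lipschitz g \<longrightarrow>
          integrable M (\<lambda>t. (g t)\<^sup>2) \<longrightarrow>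
          integrable M (\<lambda>t. (g t)\<^sup>2 * ln ((g t)\<^sup>2)) \<longrightarrow>
          integrable M (\<lambda>t. (local_slope g t)\<^sup>2) \<longrightarrow>
          (\<integral>t. (g t)\<^sup>2 * ln ((g t)\<^sup>2) \<partial>M)
            - (\<integral>t. (g t)\<^sup>2 \<partial>M) * ln (\<integral>t. (g t)\<^sup>2 \<partial>M)
          \<le> C * (\<integral>t. (local_slope g t)\<^sup>2 \<partial>M))"

text \<open>A dataset is given by a sequence \<open>x\<close> of design points and a sequence \<open>y\<close> of responses,
  both indexed from \<open>1\<close>; only the indices \<open>1, \<dots>, N0 + N1\<close> are used.\<close>

definition est_H :: "nat \<Rightarrow> real \<Rightarrow> (nat \<Rightarrow> 'a::metric_space) \<Rightarrow> nat \<Rightarrow> nat \<Rightarrow> nat" where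
  "est_H N0 \<beta> x i k = of_bool (dist (x (N0 + i)) (x k) \<le> \<beta>)"

definition est_G ::
    "nat \<Rightarrow> nat \<Rightarrow> real \<Rightarrow> nat \<Rightarrow> (nat \<Rightarrow> 'a::metric_space) \<Rightarrow> nat \<Rightarrow> nat \<Rightarrow> real" where
  "est_G N0 N1 \<beta> q x i k =
     1 / real q * of_bool ((\<Sum>l=1..N1. est_H N0 \<beta> x l k) \<ge> q)
       * real (est_H N0 \<beta> x i k) * of_bool ((\<Sum>l=1..i. est_H N0 \<beta> x l k) \<le> q)"

definition est_V ::
    "nat \<Rightarrow> nat \<Rightarrow> real \<Rightarrow> nat \<Rightarrow> (nat \<Rightarrow> 'a::metric_space) \<Rightarrow> (nat \<Rightarrow> real) \<Rightarrow> nat \<Rightarrow> real" where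
  "est_V N0 N1 \<beta> q x y k = (\<Sum>i=1..N1. y (N0 + i) * est_G N0 N1 \<beta> q x i k)"

definition estimator ::
    "nat \<Rightarrow> nat \<Rightarrow> real \<Rightarrow> nat \<Rightarrow> real \<Rightarrow> (nat \<Rightarrow> 'a::metric_space) \<Rightarrow> (nat \<Rightarrow> real) \<Rightarrow> 'a \<Rightarrow> real" where
  "estimator N0 N1 \<beta> q L x y z =
     1 / 2 * (Min ((\<lambda>k. est_V N0 N1 \<beta> q x y k + L * dist z (x k)) ` {1..N0})
            + Max ((\<lambda>k. est_V N0 N1 \<beta> q x y k - L * dist z (x k)) ` {1..N0}))"

end

theory Submission
  imports Defs
begin

text \<open>Three kinds of events can go wrong, with total probabilities at most \<open>\<delta>/4\<close>, \<open>\<delta>/4\<close> and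
  \<open>\<delta>/2\<close>: some ball of a minimal cover by \<open>\<epsilon>/8\<close>-balls contains no reference point; some reference
  point has fewer than \<open>q\<close> neighbours in the averaging block (Chernoff, conditionally on the
  reference point); some averaged noise exceeds \<open>t = \<epsilon> \<surd>(C ln (4 N\<^sub>0 / \<delta>))\<close>. Conditionally on the
  design, an averaged noise has weights whose squares sum to at most \<open>1/q\<close>, and the log-Sobolev
  inequality gives \<open>E exp (l \<xi>) \<le> exp (C l\<^sup>2 / 4)\<close> by Herbst's argument, applied to the smooth bounded
  truncations \<open>n arctan (t / n)\<close> of the identity. Outside these events every \<open>V\<^sub>k\<close> is within
  \<open>\<epsilon>/2 + t\<close> of \<open>f (X\<^sub>k)\<close> and the reference points form an \<open>\<epsilon>/4\<close>-net, so both the upper and the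
  lower Lipschitz envelope, and hence their mean, stay close to \<open>f\<close>.\<close>

text \<open>The weights \<open>est_G\<close> and the neighbourhoods depend on the random design, so
  a tail bound for fixed weights does not apply directly. Such bounds are therefore proved for a
  frozen first coordinate, uniformly in it, and then integrated against a product law. For the noise
  this requires the whole design vector to be independent of the whole noise vector, while the
  hypotheses only give independence between the pairs and, through
  \<open>design_noise_indep\<close>, inside each pair. A second obstacle is that \<open>'a\<close>
  is merely a metric space with compact universe: measurability of distances between random points,
  and of the event in the conclusion, is recovered from a countable dense set. The budget: the
  moment bound gives the tail exponent \<open>t\<^sup>2 q / C\<close>, which is at least
  \<open>ln (4 N0 / \<delta>)\<close> because \<open>q\<close> is at least
  \<open>1 / \<epsilon>\<^sup>2\<close>. In the error, the lower envelope of the data is off by the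
  net width on one side only and the upper one on the other side only, so averaging halves that
  contribution.\<close>

section \<open>Exponential moments from the log-Sobolev inequality\<close>

text \<open>The difference quotients converge, so their upper limit is the limit. This lets the
  log-Sobolev inequality be applied to differentiable functions by computing derivatives.\<close>

lemma local_slope_eq_abs_deriv:
  assumes "(g has_real_derivative d) (at x)"
  shows "local_slope g x = \<bar>d\<bar>"
proof -
  have "((\<lambda>y. \<bar>(g y - g x) / (y - x)\<bar>) \<longlongrightarrow> \<bar>d\<bar>) (at x)"
    using assms unfolding has_field_derivative_iff by (rule tendsto_rabs)
  moreover have "\<bar>(g y - g x) / (y - x)\<bar> = \<bar>g x - g y\<bar> / \<bar>x - y\<bar>" for y
    by (simp add: abs_divide abs_minus_commute)
  ultimately have "((\<lambda>y. ereal (\<bar>g x - g y\<bar> / \<bar>x - y\<bar>)) \<longlongrightarrow> ereal \<bar>d\<bar>) (at x)"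
    by simp
  then have "Limsup (at x) (\<lambda>y. ereal (\<bar>g x - g y\<bar> / \<bar>x - y\<bar>)) = ereal \<bar>d\<bar>"
    by (intro lim_imp_Limsup) auto
  then show ?thesis
    by (simp add: local_slope_def)
qed

lemma abs_exp_diff_le:
  fixes u v R :: real
  assumes "\<bar>u\<bar> \<le> R" "\<bar>v\<bar> \<le> R"
  shows "\<bar>exp u - exp v\<bar> \<le> exp R * \<bar>u - v\<bar>"
proof -
  have "norm (exp u - exp v) \<le> exp R * norm (u - v)"
    by (rule field_differentiable_bound[where S = "{-R..R}" and f' = exp])
       (use assms in \<open>auto intro!: DERIV_subset[OF DERIV_exp]\<close>)
  then show ?thesis by simp
qed

lemma integrable_exp_bounded:
  fixes F :: "'b \<Rightarrow> real"
  assumes "finite_measure M"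
    and [measurable]: "F \<in> borel_measurable M"
    and bound: "\<And>t. \<bar>F t\<bar> \<le> B"
  shows "integrable M (\<lambda>t. exp (y * F t))"
proof -
  interpret finite_measure M by fact
  have "\<bar>y * F t\<bar> \<le> \<bar>y\<bar> * B" for t
    by (simp add: abs_mult bound mult_left_mono)
  then have "norm (exp (y * F t)) \<le> exp (\<bar>y\<bar> * B)" for t
    by (simp add: abs_le_iff)
  then show ?thesis
    by (intro integrable_const_bound[where B = "exp (\<bar>y\<bar> * B)"] AE_I2) auto
qed

text \<open>Differentiation under the integral sign: dominated convergence for the difference
  quotients along an arbitrary sequence tending to \<open>l\<close>, with a constant majorant
  supplied by the bound on \<open>F\<close>.\<close>

lemma mgf_has_derivative:
  fixes F :: "'b \<Rightarrow> real"
  assumes "finite_measure M"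
    and [measurable]: "F \<in> borel_measurable M"
    and bound: "\<And>t. \<bar>F t\<bar> \<le> B"
  shows "((\<lambda>l. \<integral>t. exp (l * F t) \<partial>M) has_real_derivative (\<integral>t. F t * exp (l * F t) \<partial>M)) (at l)"
proof -
  interpret finite_measure M by fact
  have B0: "0 \<le> B" using bound[of undefined] by simp
  have lF: "\<bar>y * F t\<bar> \<le> \<bar>y\<bar> * B" for y t
    by (simp add: abs_mult bound mult_left_mono)
  have int: "integrable M (\<lambda>t. exp (y * F t))" for y
    by (rule integrable_exp_bounded[OF finite_measure_axioms _ bound]) measurable
  show ?thesis
    unfolding has_field_derivative_iff tendsto_at_iff_sequentially comp_def
  proof (intro allI impI)
    fix y :: "nat \<Rightarrow> real"
    assume y: "\<forall>i. y i \<in> UNIV - {l}" "y \<longlonglongrightarrow> l"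
    then have ne: "y i \<noteq> l" for i by auto
    obtain K where K: "\<And>i. \<bar>y i\<bar> \<le> K"
      using convergent_imp_Bseq[OF convergentI[OF y(2)]] by (metis BseqE real_norm_def)
    \<comment> \<open>A convergent sequence is bounded, so one \<open>R\<close> controls all
      exponents \<open>y i * F t\<close> and \<open>l * F t\<close> at once; this makes the majorant
      independent of \<open>i\<close>.\<close>
    define R where "R = max K \<bar>l\<bar> * B"
    have R: "\<bar>y i * F t\<bar> \<le> R" "\<bar>l * F t\<bar> \<le> R" for i t
      unfolding R_def
      by (rule order_trans[OF lF], rule mult_right_mono, use K[of i] B0 in auto)+
    have "(\<lambda>i. \<integral>t. (exp (y i * F t) - exp (l * F t)) / (y i - l) \<partial>M)
        \<longlonglongrightarrow> (\<integral>t. F t * exp (l * F t) \<partial>M)"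
    proof (rule integral_dominated_convergence[where w = "\<lambda>_. exp R * B"])
      show "AE t in M. (\<lambda>i. (exp (y i * F t) - exp (l * F t)) / (y i - l))
          \<longlonglongrightarrow> F t * exp (l * F t)"
      proof (rule AE_I2)
        fix t
        have "((\<lambda>z. exp (z * F t)) has_real_derivative (F t * exp (l * F t))) (at l)"
          by (auto intro!: derivative_eq_intros)
        then show "(\<lambda>i. (exp (y i * F t) - exp (l * F t)) / (y i - l))
          \<longlonglongrightarrow> F t * exp (l * F t)"
          unfolding has_field_derivative_iff tendsto_at_iff_sequentially comp_def
          using y by blast
      qed
      show "AE t in M. norm ((exp (y i * F t) - exp (l * F t)) / (y i - l)) \<le> exp R * B" for i
      proof (rule AE_I2)
        fix t
        have "\<bar>exp (y i * F t) - exp (l * F t)\<bar> \<le> exp R * \<bar>y i * F t - l * F t\<bar>"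
          by (rule abs_exp_diff_le[OF R])
        also have "\<dots> = exp R * \<bar>F t\<bar> * \<bar>y i - l\<bar>"
          by (simp add: abs_mult left_diff_distrib[symmetric])
        also have "\<dots> \<le> exp R * B * \<bar>y i - l\<bar>"
          by (intro mult_right_mono mult_left_mono bound) auto
        finally show "norm ((exp (y i * F t) - exp (l * F t)) / (y i - l)) \<le> exp R * B"
          using ne[of i] by (simp add: abs_divide pos_divide_le_eq)
      qed
    qed auto
    moreover have "(\<integral>t. (exp (y i * F t) - exp (l * F t)) / (y i - l) \<partial>M)
       = ((\<integral>t. exp (y i * F t) \<partial>M) - (\<integral>t. exp (l * F t) \<partial>M)) / (y i - l)" for i
      by (simp only: integral_divide_zero Bochner_Integration.integral_diff[OF int int])
    ultimately show "(\<lambda>i. ((\<integral>t. exp (y i * F t) \<partial>M) - (\<integral>t. exp (l * F t) \<partial>M)) / (y i - l))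
        \<longlonglongrightarrow> (\<integral>t. F t * exp (l * F t) \<partial>M)"
      by (simp only:)
  qed
qed

text \<open>The test function is \<open>exp (l / 2 * F t)\<close>. Its square is
  \<open>exp (l * F t)\<close>, so the entropy turns into the left-hand side, and the squared inner
  derivative \<open>l / 2\<close> together with the slope bound produces
  \<open>l\<^sup>2 / 4\<close>. Boundedness of \<open>F\<close> secures the integrability premises
  of \<open>log_sobolev\<close>.\<close>

lemma log_sobolev_exp:
  fixes M :: "real measure" and F :: "real \<Rightarrow> real"
  assumes "prob_space M" and sets: "sets M = sets borel"
    and lsi: "log_sobolev C M" and C: "0 \<le> C"
    and F: "\<And>t. (F has_real_derivative F' t) (at t)"
    and F'm: "F' \<in> borel_measurable borel"
    and bound: "\<And>t. \<bar>F t\<bar> \<le> B" and slope: "\<And>t. \<bar>F' t\<bar> \<le> 1"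
  shows "l * (\<integral>t. F t * exp (l * F t) \<partial>M)
      - (\<integral>t. exp (l * F t) \<partial>M) * ln (\<integral>t. exp (l * F t) \<partial>M)
    \<le> C * l\<^sup>2 / 4 * (\<integral>t. exp (l * F t) \<partial>M)"
proof -
  interpret prob_space M by fact
  have B0: "0 \<le> B" using bound[of undefined] by simp
  have "continuous_on UNIV F"
    using F by (meson DERIV_isCont continuous_at_imp_continuous_on)
  then have "F \<in> borel_measurable borel"
    by (rule borel_measurable_continuous_onI)
  then have Fm[measurable]: "F \<in> borel_measurable M"
    using measurable_cong_sets[OF sets refl] by blast
  have F'm'[measurable]: "F' \<in> borel_measurable M"
    using F'm measurable_cong_sets[OF sets refl] by blast
  have lF: "\<bar>y * F t\<bar> \<le> \<bar>y\<bar> * B" for y t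
    by (simp add: abs_mult bound mult_left_mono)
  have expb: "exp (y * F t) \<le> exp (\<bar>y\<bar> * B)" for y t
    using lF[of y t] by simp
  have int: "integrable M (\<lambda>t. exp (y * F t))" for y
    by (rule integrable_exp_bounded[OF finite_measure_axioms _ bound]) measurable
  define g where "g t = exp (l / 2 * F t)" for t
  define g' where "g' t = exp (l / 2 * F t) * (l / 2 * F' t)" for t
  have g: "(g has_real_derivative g' t) (at t)" for t
    unfolding g_def g'_def by (auto intro!: derivative_eq_intros F)
  have g2: "(g t)\<^sup>2 = exp (l * F t)" for t
    by (simp add: g_def power2_eq_square exp_add[symmetric] field_simps)
  have g'2: "(g' t)\<^sup>2 \<le> l\<^sup>2 / 4 * exp (l * F t)" for t
  proof -
    have "(g' t)\<^sup>2 = l\<^sup>2 / 4 * exp (l * F t) * (F' t)\<^sup>2"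
      unfolding g'_def power_mult_distrib g2[unfolded g_def] by (simp add: power2_eq_square)
    also have "\<dots> \<le> l\<^sup>2 / 4 * exp (l * F t) * 1"
      using slope[of t] by (intro mult_left_mono) (auto simp: abs_square_le_1)
    finally show ?thesis by simp
  qed
  have slope_g: "local_slope g = (\<lambda>t. \<bar>g' t\<bar>)"
    using local_slope_eq_abs_deriv[OF g] by auto
  have g'b: "norm (g' t) \<le> exp (\<bar>l / 2\<bar> * B) * \<bar>l / 2\<bar>" for t
  proof -
    have "\<bar>l / 2\<bar> * \<bar>F' t\<bar> \<le> \<bar>l / 2\<bar> * 1"
      by (intro mult_left_mono slope) simp
    then show ?thesis
      unfolding g'_def using expb[of "l/2" t]
      by (auto simp: abs_mult intro!: mult_mono)
  qed
  have "(exp (\<bar>l / 2\<bar> * B) * \<bar>l / 2\<bar>)-lipschitz_on UNIV g"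
  proof (rule lipschitz_onI)
    show "dist (g x) (g y) \<le> exp (\<bar>l / 2\<bar> * B) * \<bar>l / 2\<bar> * dist x y" for x y
      unfolding dist_norm
      by (rule field_differentiable_bound[where S = UNIV and f' = g']) (use g g'b in auto)
  qed simp
  then have "locally_lipschitz g"
    unfolding locally_lipschitz_def by (meson lipschitz_on_subset subset_UNIV zero_less_one)
  moreover have "integrable M (\<lambda>t. (g t)\<^sup>2)"
    unfolding g2 by (rule int)
  moreover have "integrable M (\<lambda>t. (g t)\<^sup>2 * ln ((g t)\<^sup>2))"
    unfolding g2 ln_exp
  proof (rule integrable_const_bound[where B = "exp (\<bar>l\<bar> * B) * (\<bar>l\<bar> * B)"])
    show "AE t in M. norm (exp (l * F t) * (l * F t)) \<le> exp (\<bar>l\<bar> * B) * (\<bar>l\<bar> * B)"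
    proof (rule AE_I2)
      show "norm (exp (l * F t) * (l * F t)) \<le> exp (\<bar>l\<bar> * B) * (\<bar>l\<bar> * B)" for t
        unfolding real_norm_def abs_mult[of "exp _"] abs_exp_cancel
        by (rule mult_mono[OF expb lF]) simp_all
    qed
  qed measurable
  moreover have int': "integrable M (\<lambda>t. (local_slope g t)\<^sup>2)"
    unfolding slope_g power2_abs
  proof (rule Bochner_Integration.integrable_bound)
    show "integrable M (\<lambda>t. l\<^sup>2 / 4 * exp (l * F t))"
      using int by simp
    show "(\<lambda>t. (g' t)\<^sup>2) \<in> borel_measurable M"
      unfolding g'_def by measurable
    show "AE t in M. norm ((g' t)\<^sup>2) \<le> norm (l\<^sup>2 / 4 * exp (l * F t))"
      using g'2 by auto
  qed
  ultimately have "(\<integral>t. (g t)\<^sup>2 * ln ((g t)\<^sup>2) \<partial>M) - (\<integral>t. (g t)\<^sup>2 \<partial>M) * ln (\<integral>t. (g t)\<^sup>2 \<partial>M)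
      \<le> C * (\<integral>t. (local_slope g t)\<^sup>2 \<partial>M)"
    using lsi unfolding log_sobolev_def by blast
  also have "(\<integral>t. (local_slope g t)\<^sup>2 \<partial>M) \<le> (\<integral>t. l\<^sup>2 / 4 * exp (l * F t) \<partial>M)"
    by (rule integral_mono[OF int']) (use int g'2 in \<open>auto simp: slope_g\<close>)
  finally have "(\<integral>t. (g t)\<^sup>2 * ln ((g t)\<^sup>2) \<partial>M) - (\<integral>t. (g t)\<^sup>2 \<partial>M) * ln (\<integral>t. (g t)\<^sup>2 \<partial>M)
      \<le> C * (\<integral>t. l\<^sup>2 / 4 * exp (l * F t) \<partial>M)"
    using C by (simp add: mult_left_mono)
  moreover have "(\<integral>t. exp (l * F t) * (l * F t) \<partial>M) = l * (\<integral>t. F t * exp (l * F t) \<partial>M)"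
    by (simp add: mult_ac flip: integral_mult_right_zero)
  ultimately show ?thesis
    unfolding g2 ln_exp by (simp add: mult_ac)
qed

text \<open>Herbst's argument: by the log-Sobolev inequality the function
  \<open>l \<mapsto> ln (\<integral> exp (l F)) / l - C l / 4\<close> is nonincreasing on the positive half-line, and it
  tends to \<open>\<integral> F\<close> at \<open>0\<close>.\<close>

lemma herbst:
  fixes M :: "real measure" and F :: "real \<Rightarrow> real"
  assumes "prob_space M" and sets: "sets M = sets borel"
    and lsi: "log_sobolev C M" and C: "0 \<le> C"
    and F: "\<And>t. (F has_real_derivative F' t) (at t)"
    and F'm: "F' \<in> borel_measurable borel"
    and bound: "\<And>t. \<bar>F t\<bar> \<le> B" and slope: "\<And>t. \<bar>F' t\<bar> \<le> 1"
    and l: "0 < l"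
  shows "(\<integral>t. exp (l * F t) \<partial>M) \<le> exp (l * (\<integral>t. F t \<partial>M) + C * l\<^sup>2 / 4)"
proof -
  interpret prob_space M by fact
  have "continuous_on UNIV F"
    using F by (meson DERIV_isCont continuous_at_imp_continuous_on)
  then have "F \<in> borel_measurable borel"
    by (rule borel_measurable_continuous_onI)
  then have Fm[measurable]: "F \<in> borel_measurable M"
    using measurable_cong_sets[OF sets refl] by blast
  define H where "H y = (\<integral>t. exp (y * F t) \<partial>M)" for y
  define H' where "H' y = (\<integral>t. F t * exp (y * F t) \<partial>M)" for y
  have dH: "(H has_real_derivative H' y) (at y)" for y
    unfolding H_def H'_def
    by (rule mgf_has_derivative[OF finite_measure_axioms Fm bound])
  have lF: "\<bar>y * F t\<bar> \<le> \<bar>y\<bar> * B" for y t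
    by (simp add: abs_mult bound mult_left_mono)
  have int: "integrable M (\<lambda>t. exp (y * F t))" for y
    by (rule integrable_exp_bounded[OF finite_measure_axioms _ bound]) measurable
  have Hpos: "0 < H y" for y
  proof -
    have "exp (- (\<bar>y\<bar> * B)) = (\<integral>t. exp (- (\<bar>y\<bar> * B)) \<partial>M)"
      by (simp add: prob_space)
    also have "\<dots> \<le> H y"
      unfolding H_def using abs_le_D2[OF lF[of y]]
      by (intro integral_mono int) (auto simp: minus_le_iff)
    finally show ?thesis using exp_gt_zero by (rule less_le_trans[rotated])
  qed
  have H0: "H 0 = 1" "H' 0 = (\<integral>t. F t \<partial>M)"
    by (simp_all add: H_def H'_def prob_space)
  define K where "K y = ln (H y) / y - C * y / 4" for y
  have dK: "(K has_real_derivative ((H' y / H y) * y - ln (H y)) / y\<^sup>2 - C / 4) (at y)"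
    if "0 < y" for y
    unfolding K_def using that Hpos[of y]
    by (auto intro!: derivative_eq_intros dH simp: power2_eq_square)
  \<comment> \<open>This is the log-Sobolev inequality for \<open>exp (y * F t)\<close> divided by
    \<open>y\<^sup>2 * H y\<close>.\<close>
  have dK_le: "((H' y / H y) * y - ln (H y)) / y\<^sup>2 - C / 4 \<le> 0" if "0 < y" for y
  proof -
    have "y * H' y - H y * ln (H y) \<le> C * y\<^sup>2 / 4 * H y"
      unfolding H_def H'_def
      by (rule log_sobolev_exp[OF assms(1) sets lsi C F F'm bound slope])
    then show ?thesis
      using that Hpos[of y] by (simp add: field_simps)
  qed
  have mono: "K l \<le> K y" if "0 < y" "y < l" for y
  proof (rule DERIV_nonpos_imp_nonincreasing[of y l K])
    show "\<exists>d. (K has_real_derivative d) (at z) \<and> d \<le> 0" if "y \<le> z" for z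
      using dK[of z] dK_le[of z] that \<open>0 < y\<close> by (intro exI conjI) auto
  qed (use that in simp)
  \<comment> \<open>Since \<open>H 0 = 1\<close>, the quotient \<open>ln (H y) / y\<close> is the
    difference quotient of \<open>ln H\<close> at \<open>0\<close>, and its limit is
    \<open>H' 0 / H 0\<close>, the mean of \<open>F\<close>.\<close>
  have "((\<lambda>y. ln (H y)) has_real_derivative (\<integral>t. F t \<partial>M)) (at 0)"
    using Hpos[of 0] by (auto intro!: derivative_eq_intros dH simp: H0)
  then have "((\<lambda>y. ln (H y) / y) \<longlongrightarrow> (\<integral>t. F t \<partial>M)) (at 0)"
    by (simp add: has_field_derivative_iff H0)
  then have "(K \<longlongrightarrow> (\<integral>t. F t \<partial>M) - C * 0 / 4) (at 0)"
    unfolding K_def by (intro tendsto_intros) auto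
  then have "(K \<longlongrightarrow> (\<integral>t. F t \<partial>M)) (at_right 0)"
    by (simp add: filterlim_at_split)
  moreover have "\<forall>\<^sub>F y in at_right 0. K l \<le> K y"
    using mono l by (auto simp: eventually_at_right_field)
  ultimately have "K l \<le> (\<integral>t. F t \<partial>M)"
    by (rule tendsto_lowerbound) simp
  then have "ln (H l) \<le> l * (\<integral>t. F t \<partial>M) + C * l\<^sup>2 / 4"
    using l by (simp add: K_def field_simps power2_eq_square)
  then have "exp (ln (H l)) \<le> exp (l * (\<integral>t. F t \<partial>M) + C * l\<^sup>2 / 4)"
    by simp
  then have "H l \<le> exp (l * (\<integral>t. F t \<partial>M) + C * l\<^sup>2 / 4)"
    by (simp only: exp_ln[OF Hpos])
  then show ?thesis
    by (simp only: H_def)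
qed

text \<open>This is the unit slope of arctan at \<open>0\<close>, rescaled by \<open>x\<close>. The
  case \<open>x = 0\<close> is separate because the limit defining a derivative avoids the point
  itself.\<close>

lemma tendsto_mult_arctan:
  "(\<lambda>n. real (Suc n) * arctan (x / real (Suc n))) \<longlonglongrightarrow> x"
proof (cases "x = 0")
  case False
  have "((\<lambda>h. arctan h / h) \<longlongrightarrow> 1) (at 0)"
    using DERIV_arctan[of 0] by (simp add: has_field_derivative_iff)
  moreover have "(\<lambda>n. x * inverse (real (Suc n))) \<longlonglongrightarrow> x * 0"
    by (intro tendsto_intros LIMSEQ_inverse_real_of_nat)
  ultimately have "(\<lambda>n. arctan (x / real (Suc n)) / (x / real (Suc n))) \<longlonglongrightarrow> 1"
    using False unfolding tendsto_at_iff_sequentially comp_def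
    by (elim allE[of _ "\<lambda>n. x / real (Suc n)"]) (simp add: divide_inverse del: of_nat_Suc)
  then have "(\<lambda>n. x * (arctan (x / real (Suc n)) / (x / real (Suc n)))) \<longlonglongrightarrow> x * 1"
    by (intro tendsto_intros)
  then show ?thesis
    using False by (simp add: mult.commute del: of_nat_Suc)
qed simp

text \<open>Herbst's bound covers bounded functions only, and exponential integrability of the
  identity is part of the claim. Hence the bound is applied to truncations and passed to the limit
  by Fatou's lemma.\<close>

lemma log_sobolev_mgf:
  fixes M :: "real measure"
  assumes "prob_space M" and sets: "sets M = sets borel"
    and lsi: "log_sobolev C M" and C: "0 \<le> C"
    and int: "integrable M (\<lambda>t. t)" and centred: "(\<integral>t. t \<partial>M) = 0"
  shows "integrable M (\<lambda>t. exp (l * t))" "(\<integral>t. exp (l * t) \<partial>M) \<le> exp (C * l\<^sup>2 / 4)"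
proof -
  interpret prob_space M by fact
  have bm: "h \<in> borel_measurable M" if "h \<in> borel_measurable borel" for h :: "real \<Rightarrow> real"
    using that measurable_cong_sets[OF sets refl] by blast
  \<comment> \<open>Stated for the nonnegative integral, which makes sense before integrability is
    known; both claims are read off from it.\<close>
  have main: "(\<integral>\<^sup>+t. ennreal (exp (l * t)) \<partial>M) \<le> ennreal (exp (C * l\<^sup>2 / 4))"
  proof (cases "l = 0")
    case True
    then show ?thesis by (simp add: emeasure_space_1)
  next
    case False
    \<comment> \<open>Herbst's bound is for positive parameters, so the sign of \<open>l\<close> is
      moved into the truncated function.\<close>
    define \<sigma> where "\<sigma> = sgn l"
    have \<sigma>: "\<bar>\<sigma>\<bar> = 1" "\<bar>l\<bar> * \<sigma> = l"
      using False by (auto simp: \<sigma>_def sgn_real_def)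
    \<comment> \<open>The sup bound of \<open>F n\<close> grows with \<open>n\<close>, but the slope
      stays at most \<open>1\<close>, and the conclusion of \<open>herbst\<close> depends on the
      slope and the mean only.\<close>
    define F where "F n t = real (Suc n) * arctan (\<sigma> * t / real (Suc n))" for n t
    define F' where "F' n t = \<sigma> / (1 + (\<sigma> * t / real (Suc n))\<^sup>2)" for n t
    have Fm: "F n \<in> borel_measurable M" for n
      unfolding F_def by (intro bm borel_measurable_continuous_onI continuous_intros) auto
    have F: "(F n has_real_derivative F' n t) (at t)" for n t
    proof -
      have "(F n has_real_derivative
          real (Suc n) * (inverse (1 + (\<sigma> * t / real (Suc n))\<^sup>2) * (\<sigma> / real (Suc n)))) (at t)"
        unfolding F_def by (rule derivative_eq_intros refl | simp)+
      moreover have "r * (inverse d * (\<sigma> / r)) = \<sigma> / d" if "r \<noteq> 0" for r d :: real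
        using that by (simp add: divide_inverse)
      ultimately show ?thesis
        unfolding F'_def by (metis of_nat_0_neq nat.distinct(1) of_nat_eq_0_iff)
    qed
    have F'm: "F' n \<in> borel_measurable borel" for n
      unfolding F'_def by measurable
    have bound: "\<bar>F n t\<bar> \<le> real (Suc n) * (pi / 2)" for n t
      using arctan_bounded[of "\<sigma> * t / real (Suc n)"]
      unfolding F_def abs_mult by (intro mult_mono) (auto simp: abs_le_iff)
    have slope: "\<bar>F' n t\<bar> \<le> 1" for n t
    proof -
      have "\<bar>F' n t\<bar> = 1 / (1 + (\<sigma> * t / real (Suc n))\<^sup>2)"
        using \<sigma>(1) by (simp add: F'_def abs_divide)
      also have "\<dots> \<le> 1"
        using add_pos_nonneg[OF zero_less_one zero_le_power2[of "\<sigma> * t / real (Suc n)"]]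
        by (simp add: divide_le_eq_1 del: of_nat_Suc)
      finally show ?thesis .
    qed
    have le: "\<bar>F n t\<bar> \<le> \<bar>t\<bar>" for n t
    proof -
      have "\<bar>F n t\<bar> \<le> real (Suc n) * \<bar>\<sigma> * t / real (Suc n)\<bar>"
        unfolding F_def abs_mult by (intro mult_mono abs_arctan_le) auto
      also have "\<dots> = \<bar>t\<bar>"
        using \<sigma>(1) by (simp add: abs_mult abs_divide)
      finally show ?thesis .
    qed
    have lim: "(\<lambda>n. F n t) \<longlonglongrightarrow> \<sigma> * t" for t
      unfolding F_def by (rule tendsto_mult_arctan)
    \<comment> \<open>The truncations need not be centred; domination by
      \<open>\<bar>t\<bar>\<close> makes their means tend to the mean of
      \<open>\<sigma> * t\<close>, which is \<open>0\<close>.\<close>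
    have "(\<lambda>n. \<integral>t. F n t \<partial>M) \<longlonglongrightarrow> (\<integral>t. \<sigma> * t \<partial>M)"
    proof (rule integral_dominated_convergence[where w = "\<lambda>t. \<bar>t\<bar>"])
      show "(\<lambda>t. \<sigma> * t) \<in> borel_measurable M"
        by (rule bm) measurable
      show "integrable M (\<lambda>t. \<bar>t\<bar>)"
        using int by (rule integrable_abs)
      show "AE t in M. norm (F n t) \<le> \<bar>t\<bar>" for n
        unfolding real_norm_def by (intro AE_I2 le)
    qed (rule Fm, intro AE_I2 lim)
    then have means: "(\<lambda>n. \<integral>t. F n t \<partial>M) \<longlonglongrightarrow> 0"
      by (simp add: centred)
    have intE: "integrable M (\<lambda>t. exp (\<bar>l\<bar> * F n t))" for n
      by (rule integrable_exp_bounded[OF finite_measure_axioms Fm bound])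
    have upper: "(\<integral>\<^sup>+t. ennreal (exp (\<bar>l\<bar> * F n t)) \<partial>M)
        \<le> ennreal (exp (\<bar>l\<bar> * (\<integral>t. F n t \<partial>M) + C * l\<^sup>2 / 4))" for n
      using herbst[OF assms(1) sets lsi C F F'm bound slope, of "\<bar>l\<bar>" n] False
      by (subst nn_integral_eq_integral[OF intE]) (auto intro!: ennreal_leI)
    have "(\<integral>\<^sup>+t. ennreal (exp (l * t)) \<partial>M)
        = (\<integral>\<^sup>+t. liminf (\<lambda>n. ennreal (exp (\<bar>l\<bar> * F n t))) \<partial>M)"
    proof (rule nn_integral_cong)
      fix t
      have "(\<lambda>n. ennreal (exp (\<bar>l\<bar> * F n t))) \<longlonglongrightarrow> ennreal (exp (\<bar>l\<bar> * (\<sigma> * t)))"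
        by (intro tendsto_intros tendsto_ennrealI lim)
      then show "ennreal (exp (l * t)) = liminf (\<lambda>n. ennreal (exp (\<bar>l\<bar> * F n t)))"
        using \<sigma>(2) by (subst lim_imp_Liminf) (auto simp: mult.assoc[symmetric])
    qed
    also have "\<dots> \<le> liminf (\<lambda>n. \<integral>\<^sup>+t. ennreal (exp (\<bar>l\<bar> * F n t)) \<partial>M)"
      using Fm by (intro nn_integral_liminf) measurable
    also have "\<dots> \<le> liminf (\<lambda>n. ennreal (exp (\<bar>l\<bar> * (\<integral>t. F n t \<partial>M) + C * l\<^sup>2 / 4)))"
      by (intro Liminf_mono always_eventually allI upper)
    also have "\<dots> = ennreal (exp (C * l\<^sup>2 / 4))"
    proof (rule lim_imp_Liminf)
      have "(\<lambda>n. ennreal (exp (\<bar>l\<bar> * (\<integral>t. F n t \<partial>M) + C * l\<^sup>2 / 4)))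
          \<longlonglongrightarrow> ennreal (exp (\<bar>l\<bar> * 0 + C * l\<^sup>2 / 4))"
        by (intro tendsto_intros tendsto_ennrealI means)
      then show "(\<lambda>n. ennreal (exp (\<bar>l\<bar> * (\<integral>t. F n t \<partial>M) + C * l\<^sup>2 / 4)))
          \<longlonglongrightarrow> ennreal (exp (C * l\<^sup>2 / 4))"
        by simp
    qed simp
    finally show ?thesis .
  qed
  show I: "integrable M (\<lambda>t. exp (l * t))"
  proof (rule integrableI_nonneg)
    show "(\<lambda>t. exp (l * t)) \<in> borel_measurable M"
      by (rule bm) measurable
    show "(\<integral>\<^sup>+t. ennreal (exp (l * t)) \<partial>M) < \<infinity>"
      using main by (rule order.strict_trans1) simp
  qed simp
  show "(\<integral>t. exp (l * t) \<partial>M) \<le> exp (C * l\<^sup>2 / 4)"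
    using main by (subst (asm) nn_integral_eq_integral[OF I]) auto
qed

section \<open>Compact metric spaces and the estimator\<close>

text \<open>The union of finite nets of radius \<open>1 / Suc n\<close>, provided by total
  boundedness.\<close>

lemma compact_countable_dense:
  assumes "compact (UNIV :: 'a::metric_space set)"
  obtains D :: "'a::metric_space set" where "countable D" "closure D = UNIV"
proof -
  have "\<forall>n::nat. \<exists>k::'a set. finite k \<and> UNIV \<subseteq> (\<Union>x\<in>k. ball x (1 / real (Suc n)))"
    using assms unfolding compact_eq_totally_bounded by simp
  then obtain k :: "nat \<Rightarrow> 'a set" where k: "\<And>n. finite (k n)"
      "\<And>n. UNIV \<subseteq> (\<Union>x\<in>k n. ball x (1 / real (Suc n)))"
    by metis
  have "\<exists>y\<in>(\<Union>n. k n). dist y x < e" if e: "0 < e" for x e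
  proof -
    obtain n where "1 / real (Suc n) < e"
      using e by (rule nat_approx_posE)
    moreover obtain y where "y \<in> k n" "dist y x < 1 / real (Suc n)"
      using k(2)[of n] by (auto simp: subset_eq)
    ultimately show ?thesis
      by (meson UN_iff UNIV_I less_trans)
  qed
  then have "closure (\<Union>n. k n) = UNIV"
    by (auto simp: closure_approachable)
  then show ?thesis
    using k(1) that[of "\<Union>n. k n"] by (simp add: countable_finite)
qed

text \<open>The triangle inequality is nearly an equality when the intermediate point is close to
  \<open>y\<close>. The right-hand side separates the two variables.\<close>

lemma dist_eq_INF_dense:
  assumes "closure D = UNIV"
  shows "dist x y = (INF d\<in>D. dist x d + dist d y)"
proof (rule sym, rule cInf_eq_non_empty)
  show "(\<lambda>d. dist x d + dist d y) ` D \<noteq> {}"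
    using assms by auto
  show "dist x y \<le> z" if "z \<in> (\<lambda>d. dist x d + dist d y) ` D" for z
    using that by (auto intro: dist_triangle)
  fix z assume z: "\<And>w. w \<in> (\<lambda>d. dist x d + dist d y) ` D \<Longrightarrow> z \<le> w"
  show "z \<le> dist x y"
  proof (rule field_le_epsilon)
    fix e :: real assume "0 < e"
    then obtain d where d: "d \<in> D" "dist d y < e / 2"
      using assms closure_approachable[of y D] by (metis UNIV_I half_gt_zero)
    then have "z \<le> dist x d + dist d y"
      by (intro z) auto
    also have "\<dots> \<le> dist x y + e"
      using d(2) dist_triangle[of x d y] by (simp add: dist_commute)
    finally show "z \<le> dist x y + e" .
  qed
qed

text \<open>The class \<open>metric_space\<close> does not provide second countability, so Borel
  measurability of the pair of \<open>g\<close> and \<open>h\<close> is not automatic. The distance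
  is instead written as a countable infimum of sums of functions of one variable each.\<close>

lemma borel_measurable_dist_compact:
  fixes g h :: "'b \<Rightarrow> 'a::metric_space"
  assumes "compact (UNIV :: 'a set)"
    and g: "g \<in> borel_measurable M" and h: "h \<in> borel_measurable M"
  shows "(\<lambda>w. dist (g w) (h w)) \<in> borel_measurable M"
proof -
  obtain D :: "'a set" where D: "countable D" "closure D = UNIV"
    using compact_countable_dense[OF assms(1)] .
  have "(\<lambda>x. dist d x) \<in> borel_measurable borel" for d :: 'a
    by (intro borel_measurable_continuous_onI continuous_intros)
  from measurable_compose[OF g this] measurable_compose[OF h this]
  have m: "(\<lambda>w. dist (g w) d + dist d (h w)) \<in> borel_measurable M" for d
    by (intro borel_measurable_add) (simp_all add: dist_commute)
  have "(\<lambda>w. INF d\<in>D. dist (g w) d + dist d (h w)) \<in> borel_measurable M"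
  proof (rule borel_measurable_cINF[OF D(1) m])
    show "bdd_below ((\<lambda>d. dist (g w) d + dist d (h w)) ` D)" for w
      by (rule bdd_belowI2[of _ 0]) simp
  qed
  moreover have "(\<lambda>w. dist (g w) (h w)) = (\<lambda>w. INF d\<in>D. dist (g w) d + dist d (h w))"
    by (intro ext dist_eq_INF_dense D)
  ultimately show ?thesis
    by (rule ssubst[rotated])
qed

lemma sup_norm_le_iff:
  fixes h :: "'b \<Rightarrow> real"
  assumes "bdd_above (range (\<lambda>x. \<bar>h x\<bar>))"
  shows "sup_norm h \<le> c \<longleftrightarrow> (\<forall>x. \<bar>h x\<bar> \<le> c)"
  unfolding sup_norm_def using cSUP_le_iff[OF UNIV_not_empty assms] by simp

text \<open>Replaces the uniform error bound, a condition at every point of the space, by countably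
  many conditions.\<close>

lemma closure_le_continuous:
  fixes h :: "'b::topological_space \<Rightarrow> real"
  assumes "closure D = UNIV" "continuous_on UNIV h" "\<And>x. x \<in> D \<Longrightarrow> h x \<le> c"
  shows "h x \<le> c"
proof -
  have "closed {x. h x \<le> c}"
    using assms(2) by (intro closed_Collect_le) auto
  then have "closure D \<subseteq> {x. h x \<le> c}"
    using assms(3) by (intro closure_minimal) auto
  then show ?thesis using assms(1) by auto
qed

text \<open>Total boundedness makes the set of cardinalities nonempty, and a nonempty set of
  naturals contains its infimum.\<close>

lemma covering_number_attained:
  fixes r :: real
  assumes "compact (UNIV :: 'a::metric_space set)" "0 < r"
  obtains A :: "'a::metric_space set"
  where "finite A" "UNIV \<subseteq> (\<Union>x\<in>A. ball x r)" "card A = covering_number (UNIV :: 'a set) r"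
proof -
  let ?N = "{card A | A. finite A \<and> A \<subseteq> (UNIV :: 'a set) \<and> UNIV \<subseteq> (\<Union>x\<in>A. ball x r)}"
  have "?N \<noteq> {}"
    using assms unfolding compact_eq_totally_bounded by auto
  then have "covering_number (UNIV :: 'a set) r \<in> ?N"
    unfolding covering_number_def by (rule Inf_nat_def1)
  then show ?thesis using that by auto
qed

text \<open>Evaluate at \<open>x\<close> the function that attains the minimum at \<open>y\<close>,
  then exchange the roles of \<open>x\<close> and \<open>y\<close>.\<close>

lemma lipschitz_on_Min:
  fixes h :: "'k \<Rightarrow> 'a::metric_space \<Rightarrow> real"
  assumes "finite I" "I \<noteq> {}" "\<And>i. i \<in> I \<Longrightarrow> L-lipschitz_on S (h i)"
  shows "L-lipschitz_on S (\<lambda>x. Min ((\<lambda>i. h i x) ` I))"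
proof (rule lipschitz_onI)
  show L: "0 \<le> L"
    using assms(2,3) lipschitz_on_nonneg by fastforce
  have le: "Min ((\<lambda>i. h i x) ` I) \<le> Min ((\<lambda>i. h i y) ` I) + L * dist x y"
    if "x \<in> S" "y \<in> S" for x y
  proof -
    have "Min ((\<lambda>i. h i y) ` I) \<in> (\<lambda>i. h i y) ` I"
      using assms(1,2) by (intro Min_in) auto
    then obtain i where i: "i \<in> I" "Min ((\<lambda>i. h i y) ` I) = h i y"
      by auto
    then have "Min ((\<lambda>i. h i x) ` I) \<le> h i x"
      using assms(1) by (intro Min_le) auto
    also have "\<dots> \<le> h i y + L * dist x y"
      using lipschitz_onD[OF assms(3)[OF i(1)] that] by (simp add: dist_real_def abs_le_iff)
    finally show ?thesis using i(2) by simp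
  qed
  show "dist (Min ((\<lambda>i. h i x) ` I)) (Min ((\<lambda>i. h i y) ` I)) \<le> L * dist x y"
    if "x \<in> S" "y \<in> S" for x y
    using le[OF that] le[OF that(2,1)] by (simp add: dist_real_def abs_le_iff dist_commute)
qed

lemma Max_eq_uminus_Min:
  fixes h :: "'k \<Rightarrow> real"
  assumes "finite I" "I \<noteq> {}"
  shows "Max (h ` I) = - Min ((\<lambda>i. - h i) ` I)"
proof -
  have "- Max (h ` I) = Min (uminus ` (h ` I))"
    using assms by (intro minus_Max_eq_Min) auto
  then show ?thesis by (simp add: image_image)
qed

text \<open>Each cone \<open>V k + L * dist z (x k)\<close> is \<open>L\<close>-Lipschitz. The
  maximum is the negative of a minimum of such cones with reflected apex heights, so one lemma on
  minima serves both envelopes, and halving their sum keeps the constant \<open>L\<close>.\<close>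

lemma lipschitz_on_estimator:
  fixes x :: "nat \<Rightarrow> 'a::metric_space"
  assumes "1 \<le> N0" "0 \<le> L"
  shows "L-lipschitz_on UNIV (estimator N0 N1 \<beta> q L x y)"
proof -
  define V where "V = est_V N0 N1 \<beta> q x y"
  have cone: "L-lipschitz_on UNIV (\<lambda>z. c + L * dist z p)" for c and p :: 'a
  proof (rule lipschitz_onI)
    fix z w :: 'a
    have "\<bar>dist z p - dist w p\<bar> \<le> dist z w"
      by (metis abs_dist_diff_le dist_commute)
    then have "L * \<bar>dist z p - dist w p\<bar> \<le> L * dist z w"
      by (rule mult_left_mono[OF _ assms(2)])
    then show "dist (c + L * dist z p) (c + L * dist w p) \<le> L * dist z w"
      using assms(2) by (simp add: dist_real_def abs_mult flip: right_diff_distrib)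
  qed (use assms in simp)
  have mn: "L-lipschitz_on UNIV (\<lambda>z. Min ((\<lambda>k. V k + L * dist z (x k)) ` {1..N0}))"
    using assms(1) by (intro lipschitz_on_Min cone) auto
  have mx: "L-lipschitz_on UNIV (\<lambda>z. Min ((\<lambda>k. - V k + L * dist z (x k)) ` {1..N0}))"
    using assms(1) by (intro lipschitz_on_Min cone) auto
  have *: "estimator N0 N1 \<beta> q L x y z = 1 / 2 * (Min ((\<lambda>k. V k + L * dist z (x k)) ` {1..N0})
     - Min ((\<lambda>k. - V k + L * dist z (x k)) ` {1..N0}))" for z
  proof -
    have "Max ((\<lambda>k. V k - L * dist z (x k)) ` {1..N0})
        = - Min ((\<lambda>k. - (V k - L * dist z (x k))) ` {1..N0})"
      using assms(1) by (intro Max_eq_uminus_Min) auto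
    then show ?thesis
      unfolding estimator_def V_def[symmetric] by simp
  qed
  have avg: "\<bar>1 / 2 * (p - r) - 1 / 2 * (p' - r')\<bar> \<le> K"
    if "\<bar>p - p'\<bar> \<le> K" "\<bar>r - r'\<bar> \<le> K" for p r p' r' K :: real
    using that unfolding abs_le_iff by (auto simp: field_simps)
  show ?thesis
  proof (rule lipschitz_onI)
    show "dist (estimator N0 N1 \<beta> q L x y z) (estimator N0 N1 \<beta> q L x y w) \<le> L * dist z w" for z w
      unfolding * dist_real_def
      by (intro avg) (fact lipschitz_onD[OF mn UNIV_I UNIV_I, unfolded dist_real_def]
          lipschitz_onD[OF mx UNIV_I UNIV_I, unfolded dist_real_def])+
  qed fact
qed

text \<open>The running count rises by one at each index with \<open>h i = 1\<close>, so precisely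
  the first \<open>q\<close> of these indices pass the test.\<close>

lemma sum_initial_selection:
  fixes h :: "nat \<Rightarrow> nat"
  assumes "\<And>i. h i \<le> 1"
  shows "(\<Sum>i=1..n. h i * of_bool ((\<Sum>l=1..i. h l) \<le> q)) = min q (\<Sum>i=1..n. h i)"
proof (induction n)
  case (Suc n)
  then show ?case
    using assms[of "Suc n"] by (cases "h (Suc n)") auto
qed simp

lemma est_H_le_1: "est_H N0 \<beta> x i k \<le> 1"
  by (simp add: est_H_def)

lemma est_G_nonneg: "0 \<le> est_G N0 N1 \<beta> q x i k"
  by (simp add: est_G_def)

text \<open>With at least \<open>q\<close> neighbours the first \<open>q\<close> of them get weight
  \<open>1 / q\<close> each; with fewer, all weights vanish.\<close>

lemma sum_est_G:
  assumes "1 \<le> q"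
  shows "(\<Sum>i=1..N1. est_G N0 N1 \<beta> q x i k) = of_bool (q \<le> (\<Sum>l=1..N1. est_H N0 \<beta> x l k))"
proof -
  let ?h = "\<lambda>i. est_H N0 \<beta> x i k"
  have "(\<Sum>i=1..N1. est_G N0 N1 \<beta> q x i k)
    = of_bool (q \<le> (\<Sum>l=1..N1. ?h l)) / real q
      * real (\<Sum>i=1..N1. ?h i * of_bool ((\<Sum>l=1..i. ?h l) \<le> q))"
    unfolding est_G_def of_nat_sum sum_distrib_left
    by (rule sum.cong) auto
  also have "(\<Sum>i=1..N1. ?h i * of_bool ((\<Sum>l=1..i. ?h l) \<le> q)) = min q (\<Sum>i=1..N1. ?h i)"
    by (rule sum_initial_selection) (rule est_H_le_1)
  finally show ?thesis using assms by auto
qed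

text \<open>Every weight is \<open>0\<close> or \<open>1 / q\<close>, so its square is
  \<open>1 / q\<close> times itself. The resulting \<open>1 / q\<close> is the variance gain from
  averaging.\<close>

lemma sum_est_G_square_le:
  assumes "1 \<le> q"
  shows "(\<Sum>i=1..N1. (est_G N0 N1 \<beta> q x i k)\<^sup>2) \<le> 1 / real q"
proof -
  have "(\<Sum>i=1..N1. (est_G N0 N1 \<beta> q x i k)\<^sup>2) = 1 / real q * (\<Sum>i=1..N1. est_G N0 N1 \<beta> q x i k)"
    unfolding sum_distrib_left
    by (rule sum.cong) (auto simp: est_G_def est_H_def power2_eq_square)
  also have "\<dots> \<le> 1 / real q * 1"
    unfolding sum_est_G[OF assms] by (intro mult_left_mono) auto
  finally show ?thesis by simp
qed

text \<open>Allows the infinite design sequence to be replaced by its restriction to the finitely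
  many sampled indices, as needed for product measures over that index set.\<close>

lemma est_G_cong:
  assumes "\<And>n. n \<in> {1..N0 + N1} \<Longrightarrow> x n = x' n" "k \<in> {1..N0}" "i \<in> {1..N1}"
  shows "est_G N0 N1 \<beta> q x i k = est_G N0 N1 \<beta> q x' i k"
proof -
  have H: "est_H N0 \<beta> x l k = est_H N0 \<beta> x' l k" if "l \<in> {1..N1}" for l
    using assms that by (simp add: est_H_def)
  have "(\<Sum>l=1..j. est_H N0 \<beta> x l k) = (\<Sum>l=1..j. est_H N0 \<beta> x' l k)" if "j \<le> N1" for j
    using that by (intro sum.cong H) auto
  from H[OF assms(3)] this[of i] this[of N1] show ?thesis
    using assms(3) by (simp add: est_G_def)
qed

text \<open>Purely deterministic. \<open>V k\<close> averages responses taken within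
  \<open>\<beta>\<close> of \<open>x k\<close>, so its bias is at most \<open>\<beta>\<close>. As
  \<open>f\<close> lies below each cone with apex \<open>f (x k)\<close>, the minimum cannot
  undershoot \<open>f z\<close> by more than \<open>\<beta> + t\<close>; overshoot is controlled at
  a near reference point and costs a further \<open>2 * \<eta>\<close>. The maximum behaves
  symmetrically, and the mean carries only \<open>\<eta>\<close>.\<close>

lemma estimator_error:
  fixes x :: "nat \<Rightarrow> 'a::metric_space" and f :: "'a \<Rightarrow> real"
  assumes f: "1-lipschitz_on UNIV f"
    and q: "1 \<le> q"
    and counts: "\<And>k. k \<in> {1..N0} \<Longrightarrow> q \<le> (\<Sum>l=1..N1. est_H N0 \<beta> x l k)"
    and noise: "\<And>k. k \<in> {1..N0} \<Longrightarrow> \<bar>\<Sum>i=1..N1. e (N0 + i) * est_G N0 N1 \<beta> q x i k\<bar> \<le> t"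
    and net: "\<exists>k\<in>{1..N0}. dist z (x k) \<le> \<eta>"
  shows "\<bar>estimator N0 N1 \<beta> q 1 x (\<lambda>n. f (x n) + e n) z - f z\<bar> \<le> \<beta> + \<eta> + t"
proof -
  define V where "V = est_V N0 N1 \<beta> q x (\<lambda>n. f (x n) + e n)"
  have lip: "\<bar>f u - f v\<bar> \<le> dist u v" for u v
    using lipschitz_onD[OF f, of u v] by (simp add: dist_real_def)
  have V: "\<bar>V k - f (x k)\<bar> \<le> \<beta> + t" if k: "k \<in> {1..N0}" for k
  proof -
    let ?G = "\<lambda>i. est_G N0 N1 \<beta> q x i k"
    have one: "(\<Sum>i=1..N1. ?G i) = 1"
      unfolding sum_est_G[OF q] using counts[OF k] by simp
    \<comment> \<open>Weights summing to one let \<open>f (x k)\<close> enter the sum, which then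
      splits into bias and noise.\<close>
    have "V k - f (x k) = (\<Sum>i=1..N1. (f (x (N0 + i)) + e (N0 + i)) * ?G i) - f (x k) * (\<Sum>i=1..N1. ?G i)"
      by (simp only: V_def est_V_def one mult_1_right)
    also have "\<dots> = (\<Sum>i=1..N1. (f (x (N0 + i)) - f (x k)) * ?G i) + (\<Sum>i=1..N1. e (N0 + i) * ?G i)"
      by (simp add: sum_distrib_left sum.distrib sum_subtractf algebra_simps)
    finally have "\<bar>V k - f (x k)\<bar>
        \<le> \<bar>\<Sum>i=1..N1. (f (x (N0 + i)) - f (x k)) * ?G i\<bar> + \<bar>\<Sum>i=1..N1. e (N0 + i) * ?G i\<bar>"
      by linarith
    also have "\<bar>\<Sum>i=1..N1. (f (x (N0 + i)) - f (x k)) * ?G i\<bar>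
        \<le> (\<Sum>i=1..N1. \<bar>(f (x (N0 + i)) - f (x k)) * ?G i\<bar>)"
      by (rule sum_abs)
    also have "\<dots> \<le> (\<Sum>i=1..N1. \<beta> * ?G i)"
    proof (rule sum_mono)
      fix i
      show "\<bar>(f (x (N0 + i)) - f (x k)) * ?G i\<bar> \<le> \<beta> * ?G i"
      proof (cases "dist (x (N0 + i)) (x k) \<le> \<beta>")
        case True
        then show ?thesis
          using lip[of "x (N0 + i)" "x k"] est_G_nonneg[of N0 N1 \<beta> q x i k]
          unfolding abs_mult by (intro mult_mono) auto
      qed (simp add: est_G_def est_H_def)
    qed
    also have "\<dots> = \<beta>"
      by (simp only: one mult_1_right flip: sum_distrib_left)
    finally show ?thesis
      using noise[OF k] by linarith
  qed
  obtain k where k: "k \<in> {1..N0}" "dist z (x k) \<le> \<eta>"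
    using net by blast
  let ?mn = "Min ((\<lambda>k. V k + 1 * dist z (x k)) ` {1..N0})"
  let ?mx = "Max ((\<lambda>k. V k - 1 * dist z (x k)) ` {1..N0})"
  have "f z - (\<beta> + t) \<le> ?mn"
  proof (rule Min.boundedI)
    fix w assume "w \<in> (\<lambda>k. V k + 1 * dist z (x k)) ` {1..N0}"
    then obtain j where "j \<in> {1..N0}" "w = V j + 1 * dist z (x j)"
      by blast
    then show "f z - (\<beta> + t) \<le> w"
      using V[of j] lip[of z "x j"] by linarith
  qed (use k in auto)
  moreover have "?mn \<le> f z + 2 * \<eta> + (\<beta> + t)"
  proof -
    have "?mn \<le> V k + 1 * dist z (x k)"
      using k(1) by (intro Min_le) auto
    then show ?thesis using V[OF k(1)] lip[of z "x k"] k(2) by linarith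
  qed
  moreover have "?mx \<le> f z + (\<beta> + t)"
  proof (rule Max.boundedI)
    fix w assume "w \<in> (\<lambda>k. V k - 1 * dist z (x k)) ` {1..N0}"
    then obtain j where "j \<in> {1..N0}" "w = V j - 1 * dist z (x j)"
      by blast
    then show "w \<le> f z + (\<beta> + t)"
      using V[of j] lip[of z "x j"] by linarith
  qed (use k in auto)
  moreover have "f z - 2 * \<eta> - (\<beta> + t) \<le> ?mx"
  proof -
    have "V k - 1 * dist z (x k) \<le> ?mx"
      using k(1) by (intro Max_ge) auto
    then show ?thesis using V[OF k(1)] lip[of z "x k"] k(2) by linarith
  qed
  ultimately show ?thesis
    unfolding estimator_def V_def[symmetric] by (intro abs_leI) (simp_all add: field_simps)
qed

section \<open>Concentration and independence\<close>

lemma (in prob_space) prob_Markov: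
  fixes u :: "'a \<Rightarrow> real"
  assumes "integrable M u" "\<And>x. 0 \<le> u x" "0 < c"
  shows "prob {x \<in> space M. c \<le> u x} \<le> expectation u / c"
  by (rule integral_Markov_inequality_measure[OF assms(1) sets.empty_sets]) (use assms in auto)

text \<open>Chernoff's method: the exponential moment of the weighted sum factorises by
  independence, and the weights enter only through the sum of their squares.\<close>

lemma (in prob_space) subgaussian_weighted_tail:
  fixes Y :: "'i \<Rightarrow> 'a \<Rightarrow> real"
  assumes I: "finite I" and indep: "indep_vars (\<lambda>_. borel) Y I"
    and int: "\<And>i l. i \<in> I \<Longrightarrow> integrable M (\<lambda>\<omega>. exp (l * Y i \<omega>))"
    and mgf: "\<And>i l. i \<in> I \<Longrightarrow> expectation (\<lambda>\<omega>. exp (l * Y i \<omega>)) \<le> exp (C * l\<^sup>2 / 4)"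
    and w: "(\<Sum>i\<in>I. (w i)\<^sup>2) \<le> v" and pos: "0 < C" "0 < v" "0 < t"
  shows "prob {\<omega> \<in> space M. t \<le> (\<Sum>i\<in>I. Y i \<omega> * w i)} \<le> exp (- (t\<^sup>2 / (C * v)))"
proof -
  \<comment> \<open>The minimiser of \<open>C * l\<^sup>2 / 4 * v - l * t\<close>, with minimum
    \<open>- (t\<^sup>2 / (C * v))\<close>.\<close>
  define l where "l = 2 * t / (C * v)"
  have l: "0 < l" using pos by (simp add: l_def)
  define S where "S \<omega> = (\<Sum>i\<in>I. Y i \<omega> * w i)" for \<omega>
  have S: "exp (l * S \<omega>) = (\<Prod>i\<in>I. exp ((l * w i) * Y i \<omega>))" for \<omega>
    using I by (simp add: S_def sum_distrib_left exp_sum mult_ac)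
  have indepE: "indep_vars (\<lambda>_. borel) (\<lambda>i \<omega>. exp ((l * w i) * Y i \<omega>)) I"
    by (rule indep_vars_compose2[OF indep]) measurable
  have intS: "integrable M (\<lambda>\<omega>. exp (l * S \<omega>))"
    unfolding S by (rule indep_vars_integrable[OF I indepE int])
  have "expectation (\<lambda>\<omega>. exp (l * S \<omega>)) = (\<Prod>i\<in>I. expectation (\<lambda>\<omega>. exp ((l * w i) * Y i \<omega>)))"
    unfolding S by (rule indep_vars_lebesgue_integral[OF I indepE int])
  also have "\<dots> \<le> (\<Prod>i\<in>I. exp (C * (l * w i)\<^sup>2 / 4))"
    by (intro prod_mono conjI mgf integral_nonneg_AE AE_I2 exp_ge_zero)
  also have "\<dots> = exp (C * l\<^sup>2 / 4 * (\<Sum>i\<in>I. (w i)\<^sup>2))"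
    using I by (simp add: exp_sum[symmetric] sum_distrib_left power_mult_distrib mult_ac)
  also have "\<dots> \<le> exp (C * l\<^sup>2 / 4 * v)"
    using w pos by (simp add: mult_left_mono)
  finally have E: "expectation (\<lambda>\<omega>. exp (l * S \<omega>)) \<le> exp (C * l\<^sup>2 / 4 * v)" .
  have "{\<omega> \<in> space M. t \<le> S \<omega>} = {\<omega> \<in> space M. exp (l * t) \<le> exp (l * S \<omega>)}"
    using l by auto
  then have "prob {\<omega> \<in> space M. t \<le> S \<omega>} \<le> expectation (\<lambda>\<omega>. exp (l * S \<omega>)) / exp (l * t)"
    using prob_Markov[OF intS, of "exp (l * t)"] by simp
  also have "\<dots> \<le> exp (C * l\<^sup>2 / 4 * v) / exp (l * t)"
    by (rule divide_right_mono[OF E]) simp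
  also have "\<dots> = exp (C * l\<^sup>2 / 4 * v - l * t)"
    by (simp add: exp_diff)
  also have "C * l\<^sup>2 / 4 * v - l * t = - (t\<^sup>2 / (C * v))"
    using pos by (simp add: l_def field_simps power2_eq_square)
  finally show ?thesis by (simp add: S_def)
qed

lemma (in prob_space) subgaussian_weighted_tail_abs:
  fixes Y :: "'i \<Rightarrow> 'a \<Rightarrow> real"
  assumes I: "finite I" and indep: "indep_vars (\<lambda>_. borel) Y I"
    and int: "\<And>i l. i \<in> I \<Longrightarrow> integrable M (\<lambda>\<omega>. exp (l * Y i \<omega>))"
    and mgf: "\<And>i l. i \<in> I \<Longrightarrow> expectation (\<lambda>\<omega>. exp (l * Y i \<omega>)) \<le> exp (C * l\<^sup>2 / 4)"
    and w: "(\<Sum>i\<in>I. (w i)\<^sup>2) \<le> v" and pos: "0 < C" "0 < v" "0 < t"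
  shows "prob {\<omega> \<in> space M. t < \<bar>\<Sum>i\<in>I. Y i \<omega> * w i\<bar>} \<le> 2 * exp (- (t\<^sup>2 / (C * v)))"
proof -
  have Y[measurable]: "Y i \<in> borel_measurable M" if "i \<in> I" for i
    using indep that by (auto simp: indep_vars_def)
  have w': "(\<Sum>i\<in>I. (- w i)\<^sup>2) \<le> v" using w by simp
  have "prob {\<omega> \<in> space M. t < \<bar>\<Sum>i\<in>I. Y i \<omega> * w i\<bar>}
      \<le> prob ({\<omega> \<in> space M. t \<le> (\<Sum>i\<in>I. Y i \<omega> * w i)}
          \<union> {\<omega> \<in> space M. t \<le> (\<Sum>i\<in>I. Y i \<omega> * - w i)})"
    by (intro finite_measure_mono) (auto simp: sum_negf)
  also have "\<dots> \<le> prob {\<omega> \<in> space M. t \<le> (\<Sum>i\<in>I. Y i \<omega> * w i)}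
      + prob {\<omega> \<in> space M. t \<le> (\<Sum>i\<in>I. Y i \<omega> * - w i)}"
    by (intro measure_Un_le) auto
  also have "\<dots> \<le> exp (- (t\<^sup>2 / (C * v))) + exp (- (t\<^sup>2 / (C * v)))"
    by (intro add_mono subgaussian_weighted_tail[OF I indep int mgf _ pos] w w')
  finally show ?thesis by simp
qed

text \<open>Chernoff's bound with the moment \<open>(1 / 2) ^ S\<close> of the number \<open>S\<close> of successes.\<close>

lemma (in prob_space) success_count_lower_tail:
  assumes I: "finite I" and indep: "indep_vars (\<lambda>_. N) Y I" and A: "A \<in> sets N"
    and p: "\<And>i. i \<in> I \<Longrightarrow> p \<le> prob {\<omega> \<in> space M. Y i \<omega> \<in> A}"
    and m: "2 * real m \<le> real (card I) * p"
  shows "prob {\<omega> \<in> space M. (\<Sum>i\<in>I. of_bool (Y i \<omega> \<in> A)) < m} \<le> exp (- (real (card I) * p / 8))"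
proof -
  let ?\<phi> = "\<lambda>i \<omega>. (1 / 2 :: real) ^ of_bool (Y i \<omega> \<in> A)"
  have Y: "Y i \<in> measurable M N" if "i \<in> I" for i
    using indep that by (auto simp: indep_vars_def)
  have ev: "{\<omega> \<in> space M. Y i \<omega> \<in> A} \<in> events" if "i \<in> I" for i
    using measurable_sets[OF Y[OF that] A] by (simp add: vimage_def Int_def conj_commute)
  have phi: "?\<phi> i \<omega> = 1 - indicator {\<omega> \<in> space M. Y i \<omega> \<in> A} \<omega> / 2" if "\<omega> \<in> space M" for i \<omega>
    using that by (simp add: indicator_def)
  have indep': "indep_vars (\<lambda>_. borel) (\<lambda>i \<omega>. ?\<phi> i \<omega>) I"
  proof (rule indep_vars_compose2[OF indep])
    have "(\<lambda>y. 1 - indicator A y / 2 :: real) \<in> borel_measurable N"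
      using A by measurable
    moreover have "(\<lambda>y. (1 / 2 :: real) ^ of_bool (y \<in> A)) = (\<lambda>y. 1 - indicator A y / 2)"
      by (auto simp: indicator_def)
    ultimately show "(\<lambda>y. (1 / 2 :: real) ^ of_bool (y \<in> A)) \<in> borel_measurable N"
      by simp
  qed
  have ind: "integrable M (\<lambda>\<omega>. indicat_real {\<omega> \<in> space M. Y i \<omega> \<in> A} \<omega> / 2)" if "i \<in> I" for i
    using ev[OF that] by (auto intro!: integrable_divide integrable_real_indicator simp: emeasure_eq_measure)
  have int: "integrable M (?\<phi> i)" if "i \<in> I" for i
    by (subst Bochner_Integration.integrable_cong[OF refl phi])
       (auto intro!: Bochner_Integration.integrable_diff ind that)
  \<comment> \<open>A factor is \<open>1\<close> on failure and \<open>1 / 2\<close> on success, so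
    its mean is \<open>1 - prob / 2\<close>.\<close>
  have E: "expectation (?\<phi> i) \<le> exp (- (p / 2))" if i: "i \<in> I" for i
  proof -
    have "expectation (?\<phi> i) = expectation (\<lambda>\<omega>. 1) - expectation (\<lambda>\<omega>. indicat_real {\<omega> \<in> space M. Y i \<omega> \<in> A} \<omega> / 2)"
      by (subst Bochner_Integration.integral_cong[OF refl phi], assumption)
         (rule Bochner_Integration.integral_diff[OF _ ind[OF i]], simp)
    also have "\<dots> = 1 - prob {\<omega> \<in> space M. Y i \<omega> \<in> A} / 2"
      using ev[OF i] by (simp add: prob_space)
    also have "\<dots> \<le> 1 + - (p / 2)"
      using p[OF i] by simp
    also have "\<dots> \<le> exp (- (p / 2))"
      by (rule exp_ge_add_one_self)
    finally show ?thesis .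
  qed
  define S where "S \<omega> = (\<Sum>i\<in>I. of_bool (Y i \<omega> \<in> A) :: nat)" for \<omega>
  have S: "(1 / 2 :: real) ^ S \<omega> = (\<Prod>i\<in>I. ?\<phi> i \<omega>)" for \<omega>
    by (simp only: S_def power_sum)
  have intS: "integrable M (\<lambda>\<omega>. (1 / 2 :: real) ^ S \<omega>)"
    unfolding S by (rule indep_vars_integrable[OF I indep' int])
  have "expectation (\<lambda>\<omega>. (1 / 2 :: real) ^ S \<omega>) = (\<Prod>i\<in>I. expectation (?\<phi> i))"
    unfolding S by (rule indep_vars_lebesgue_integral[OF I indep' int])
  also have "\<dots> \<le> (\<Prod>i\<in>I. exp (- (p / 2)))"
    by (intro prod_mono conjI E integral_nonneg_AE AE_I2) auto
  also have "\<dots> = exp (- (real (card I) * p / 2))"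
    by (simp add: exp_of_nat_mult[symmetric])
  finally have ES: "expectation (\<lambda>\<omega>. (1 / 2 :: real) ^ S \<omega>) \<le> exp (- (real (card I) * p / 2))" .
  have "prob {\<omega> \<in> space M. S \<omega> < m} \<le> prob {\<omega> \<in> space M. (1 / 2 :: real) ^ m \<le> (1 / 2) ^ S \<omega>}"
  proof (rule finite_measure_mono)
    show "{\<omega> \<in> space M. (1 / 2 :: real) ^ m \<le> (1 / 2) ^ S \<omega>} \<in> events"
      using borel_measurable_integrable[OF intS] by measurable
  qed (auto intro!: power_decreasing)
  also have "\<dots> \<le> expectation (\<lambda>\<omega>. (1 / 2 :: real) ^ S \<omega>) / (1 / 2) ^ m"
    by (rule prob_Markov[OF intS]) auto
  also have "\<dots> \<le> exp (- (real (card I) * p / 2)) / (1 / 2) ^ m"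
    by (rule divide_right_mono[OF ES]) simp
  also have "\<dots> = exp (- (real (card I) * p / 2)) * 2 ^ m"
    by (simp add: power_one_over)
  \<comment> \<open>Any exponent between \<open>ln 2\<close> and \<open>1\<close> would leave a
    negative total. With \<open>3 / 4\<close> and \<open>m\<close> at most half of
    \<open>card I * p\<close>, the loss is at most \<open>3 / 8\<close> of
    \<open>card I * p\<close>, leaving \<open>1 / 2 - 3 / 8 = 1 / 8\<close>.\<close>
  also have "\<dots> \<le> exp (- (real (card I) * p / 2)) * exp (3 / 4) ^ m"
  proof (intro mult_left_mono power_mono)
    show "(2 :: real) \<le> exp (3 / 4)"
      using exp_lower_Taylor_quadratic[of "3 / 4 :: real"] by (simp add: power2_eq_square)
  qed auto
  also have "\<dots> = exp (- (real (card I) * p / 2) + real m * (3 / 4))"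
    by (simp only: exp_add exp_of_nat_mult)
  also have "\<dots> \<le> exp (- (real (card I) * p / 8))"
    using m by simp
  finally show ?thesis by (simp add: S_def)
qed

text \<open>By independence the probability is a product, each factor being at most
  \<open>1 - p\<close> and hence at most \<open>exp (- p)\<close>.\<close>

lemma (in prob_space) prob_all_miss_le:
  assumes I: "finite I" "I \<noteq> {}" and indep: "indep_vars (\<lambda>_. N) Y I" and A: "A \<in> sets N"
    and p: "\<And>i. i \<in> I \<Longrightarrow> p \<le> prob {\<omega> \<in> space M. Y i \<omega> \<in> A}"
  shows "prob {\<omega> \<in> space M. \<forall>i\<in>I. Y i \<omega> \<notin> A} \<le> exp (- (real (card I) * p))"
proof -
  have Y: "Y i \<in> measurable M N" if "i \<in> I" for i
    using indep that by (auto simp: indep_vars_def)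
  have ev: "{\<omega> \<in> space M. Y i \<omega> \<in> A} \<in> events" if "i \<in> I" for i
    using measurable_sets[OF Y[OF that] A] by (simp add: vimage_def Int_def conj_commute)
  have "{\<omega> \<in> space M. \<forall>i\<in>I. Y i \<omega> \<notin> A} = (\<Inter>i\<in>I. Y i -` (space N - A) \<inter> space M)"
    using I(2) measurable_space[OF Y] by auto
  then have "prob {\<omega> \<in> space M. \<forall>i\<in>I. Y i \<omega> \<notin> A}
      = (\<Prod>i\<in>I. prob (Y i -` (space N - A) \<inter> space M))"
    using indep_varsD_finite[OF indep I(2,1), of "\<lambda>_. space N - A"] A by auto
  also have "\<dots> \<le> (\<Prod>i\<in>I. exp (- p))"
  proof (intro prod_mono conjI measure_nonneg)
    fix i assume i: "i \<in> I"
    have "Y i -` (space N - A) \<inter> space M = space M - {\<omega> \<in> space M. Y i \<omega> \<in> A}"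
      using measurable_space[OF Y[OF i]] by auto
    then have "prob (Y i -` (space N - A) \<inter> space M) = 1 - prob {\<omega> \<in> space M. Y i \<omega> \<in> A}"
      using prob_compl[OF ev[OF i]] by simp
    also have "\<dots> \<le> 1 + - p"
      using p[OF i] by simp
    also have "\<dots> \<le> exp (- p)"
      by (rule exp_ge_add_one_self)
    finally show "prob (Y i -` (space N - A) \<inter> space M) \<le> exp (- p)" .
  qed
  also have "\<dots> = exp (- (real (card I) * p))"
    by (simp add: exp_of_nat_mult[symmetric])
  finally show ?thesis .
qed

text \<open>Fubini in place of conditional probability: under a product law, a bound on the sections
  that is uniform in the first coordinate carries over to the joint event.\<close>

lemma (in prob_space) prob_pair_le:
  assumes Y: "random_variable N Y" and Z: "random_variable L Z"
    and distr: "distr M (N \<Otimes>\<^sub>M L) (\<lambda>\<omega>. (Y \<omega>, Z \<omega>)) = distr M N Y \<Otimes>\<^sub>M distr M L Z"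
    and S: "S \<in> sets (N \<Otimes>\<^sub>M L)"
    and le: "\<And>y. y \<in> space N \<Longrightarrow> prob {\<omega> \<in> space M. (y, Z \<omega>) \<in> S} \<le> c"
  shows "prob {\<omega> \<in> space M. (Y \<omega>, Z \<omega>) \<in> S} \<le> c"
proof -
  interpret Y: prob_space "distr M N Y" using Y by (rule prob_space_distr)
  interpret Z: prob_space "distr M L Z" using Z by (rule prob_space_distr)
  obtain \<omega> where "\<omega> \<in> space M" using not_empty by auto
  then have c: "0 \<le> c"
    using le[OF measurable_space[OF Y]] measure_nonneg order_trans by blast
  have [measurable]: "(\<lambda>\<omega>. (Y \<omega>, Z \<omega>)) \<in> measurable M (N \<Otimes>\<^sub>M L)"
    using Y Z by measurable
  have "emeasure M {\<omega> \<in> space M. (Y \<omega>, Z \<omega>) \<in> S}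
      = emeasure (distr M (N \<Otimes>\<^sub>M L) (\<lambda>\<omega>. (Y \<omega>, Z \<omega>))) S"
    using S by (subst emeasure_distr) (auto intro!: arg_cong[where f = "emeasure M"])
  also have "\<dots> = (\<integral>\<^sup>+y. emeasure (distr M L Z) (Pair y -` S) \<partial>distr M N Y)"
    unfolding distr using S by (intro Z.emeasure_pair_measure_alt) simp
  also have "\<dots> \<le> (\<integral>\<^sup>+y. ennreal c \<partial>distr M N Y)"
  proof (rule nn_integral_mono)
    fix y assume "y \<in> space (distr M N Y)"
    then have y: "y \<in> space N" by simp
    have "Pair y -` S \<in> sets L"
      using S by (rule sets_Pair1)
    then have "emeasure (distr M L Z) (Pair y -` S) = emeasure M {\<omega> \<in> space M. (y, Z \<omega>) \<in> S}"
      using Z by (subst emeasure_distr) (auto intro!: arg_cong[where f = "emeasure M"])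
    also have "\<dots> \<le> ennreal c"
      using le[OF y] by (simp add: emeasure_eq_measure ennreal_leI)
    finally show "emeasure (distr M L Z) (Pair y -` S) \<le> ennreal c" .
  qed
  also have "\<dots> = ennreal c"
    using Y.emeasure_space_1 by simp
  finally show ?thesis
    using c by (simp add: emeasure_eq_measure)
qed

text \<open>Independence across \<open>I\<close> and inside each pair makes all the variables
  \<open>X i\<close>, \<open>Y i\<close> jointly independent; grouping them by kind yields
  independence of the two vectors. The pairs are measured in an arbitrary \<open>K\<close>
  containing rectangles, because in the application it is the Borel sigma-algebra of a product
  type.\<close>

lemma (in prob_space) distr_restrict_pair:
  fixes X :: "'i \<Rightarrow> 'a \<Rightarrow> 'b" and Y :: "'i \<Rightarrow> 'a \<Rightarrow> 'c"
  assumes I: "finite I" "I \<noteq> {}"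
    and X: "\<And>i. i \<in> I \<Longrightarrow> random_variable A (X i)" and Y: "\<And>i. i \<in> I \<Longrightarrow> random_variable B (Y i)"
    and indep: "indep_vars (\<lambda>_. K) (\<lambda>i \<omega>. (X i \<omega>, Y i \<omega>)) I"
    and K: "\<And>E F. E \<in> sets A \<Longrightarrow> F \<in> sets B \<Longrightarrow> E \<times> F \<in> sets K"
    and XY: "\<And>i E F. i \<in> I \<Longrightarrow> E \<in> sets A \<Longrightarrow> F \<in> sets B \<Longrightarrow>
      prob {\<omega> \<in> space M. X i \<omega> \<in> E \<and> Y i \<omega> \<in> F}
        = prob {\<omega> \<in> space M. X i \<omega> \<in> E} * prob {\<omega> \<in> space M. Y i \<omega> \<in> F}"
  shows "distr M (PiM I (\<lambda>_. A) \<Otimes>\<^sub>M PiM I (\<lambda>_. B)) (\<lambda>\<omega>. (\<lambda>i\<in>I. X i \<omega>, \<lambda>i\<in>I. Y i \<omega>))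
    = distr M (PiM I (\<lambda>_. A)) (\<lambda>\<omega>. \<lambda>i\<in>I. X i \<omega>) \<Otimes>\<^sub>M distr M (PiM I (\<lambda>_. B)) (\<lambda>\<omega>. \<lambda>i\<in>I. Y i \<omega>)"
proof -
  define G where "G = (\<lambda>(i, b). if b then {X i -` E \<inter> space M | E. E \<in> sets A}
      else {Y i -` F \<inter> space M | F. F \<in> sets B})"
  have G_simps: "G (i, True) = {X i -` E \<inter> space M | E. E \<in> sets A}"
      "G (i, False) = {Y i -` F \<inter> space M | F. F \<in> sets B}" for i
    by (simp_all add: G_def)
  have GI: "Int_stable (G j)" for j
  proof -
    have *: "Int_stable {h -` E \<inter> space M | E. E \<in> sets L}" for h :: "'a \<Rightarrow> 'd" and L
      unfolding Int_stable_def
    proof safe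
      fix E F assume "E \<in> sets L" "F \<in> sets L"
      then show "\<exists>D. h -` E \<inter> space M \<inter> (h -` F \<inter> space M) = h -` D \<inter> space M \<and> D \<in> sets L"
        by (intro exI[of _ "E \<inter> F"]) auto
    qed
    show ?thesis
      by (cases j; cases "snd j") (simp_all add: G_simps *)
  qed
  have ev: "G j \<subseteq> events" if "j \<in> I \<times> UNIV" for j
    using that X Y by (cases j; cases "snd j") (auto simp: G_simps intro: measurable_sets)
  have top: "space M \<in> G j" if "j \<in> I \<times> UNIV" for j
  proof (cases j)
    case (Pair i b)
    then have i: "i \<in> I" using that by auto
    have "X i -` space A \<inter> space M = space M" "Y i -` space B \<inter> space M = space M"
      using measurable_space[OF X[OF i]] measurable_space[OF Y[OF i]] by auto
    then have "\<exists>E\<in>sets A. space M = X i -` E \<inter> space M" "\<exists>F\<in>sets B. space M = Y i -` F \<inter> space M"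
      by (metis sets.top)+
    then show ?thesis
      unfolding Pair by (cases b) (auto simp only: G_simps)
  qed
  \<comment> \<open>Each \<open>G j\<close> contains \<open>space M\<close>, so only intersections
    over the full index set must be checked. These regroup into one rectangle event per
    \<open>i\<close>, which factorises by \<open>indep\<close> and then \<open>XY\<close>.\<close>
  have "indep_sets G (I \<times> UNIV)"
  proof (subst indep_sets_finite)
    show "\<forall>D\<in>Pi (I \<times> UNIV) G. prob (\<Inter>j\<in>I \<times> UNIV. D j) = (\<Prod>j\<in>I \<times> UNIV. prob (D j))"
    proof
      fix D assume D: "D \<in> Pi (I \<times> UNIV) G"
      have "\<exists>E\<in>sets A. D (i, True) = X i -` E \<inter> space M" if "i \<in> I" for i
        using Pi_mem[OF D, of "(i, True)"] that by (auto simp: G_simps)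
      then obtain E where E: "\<And>i. i \<in> I \<Longrightarrow> E i \<in> sets A"
          "\<And>i. i \<in> I \<Longrightarrow> D (i, True) = X i -` E i \<inter> space M"
        by metis
      have "\<exists>F\<in>sets B. D (i, False) = Y i -` F \<inter> space M" if "i \<in> I" for i
        using Pi_mem[OF D, of "(i, False)"] that by (auto simp: G_simps)
      then obtain F where F: "\<And>i. i \<in> I \<Longrightarrow> F i \<in> sets B"
          "\<And>i. i \<in> I \<Longrightarrow> D (i, False) = Y i -` F i \<inter> space M"
        by metis
      have "(\<Inter>j\<in>I \<times> UNIV. D j) = (\<Inter>i\<in>I. D (i, True) \<inter> D (i, False))"
        by (auto simp: UNIV_bool)
      also have "\<dots> = (\<Inter>i\<in>I. (\<lambda>\<omega>. (X i \<omega>, Y i \<omega>)) -` (E i \<times> F i) \<inter> space M)"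
        using E(2) F(2) by (intro INF_cong refl) auto
      also have "prob \<dots> = (\<Prod>i\<in>I. prob ((\<lambda>\<omega>. (X i \<omega>, Y i \<omega>)) -` (E i \<times> F i) \<inter> space M))"
        by (rule indep_varsD_finite[OF indep I(2,1)]) (intro K E(1) F(1))
      also have "\<dots> = (\<Prod>i\<in>I. prob (D (i, True)) * prob (D (i, False)))"
      proof (rule prod.cong[OF refl])
        fix i assume i: "i \<in> I"
        have "(\<lambda>\<omega>. (X i \<omega>, Y i \<omega>)) -` (E i \<times> F i) \<inter> space M
            = {\<omega> \<in> space M. X i \<omega> \<in> E i \<and> Y i \<omega> \<in> F i}"
          by auto
        moreover have "D (i, True) = {\<omega> \<in> space M. X i \<omega> \<in> E i}"
            "D (i, False) = {\<omega> \<in> space M. Y i \<omega> \<in> F i}"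
          using E(2)[OF i] F(2)[OF i] by auto
        ultimately show "prob ((\<lambda>\<omega>. (X i \<omega>, Y i \<omega>)) -` (E i \<times> F i) \<inter> space M)
            = prob (D (i, True)) * prob (D (i, False))"
          using XY[OF i E(1)[OF i] F(1)[OF i]] by simp
      qed
      also have "\<dots> = (\<Prod>i\<in>I. \<Prod>b\<in>UNIV. prob (D (i, b)))"
        by (simp add: UNIV_bool mult.commute)
      also have "\<dots> = (\<Prod>j\<in>I \<times> UNIV. prob (D j))"
        by (simp add: prod.cartesian_product)
      finally show "prob (\<Inter>j\<in>I \<times> UNIV. D j) = (\<Prod>j\<in>I \<times> UNIV. prob (D j))" .
    qed
  qed (use I ev top in auto)
  \<comment> \<open>Partitioning the indices by the Boolean tag turns the intersection-stable
    generators into two independent sigma-algebras, one generated by all \<open>X i\<close> and one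
    by all \<open>Y i\<close>.\<close>
  then have "indep_sets G (\<Union>b\<in>UNIV. I \<times> {b})"
    by (rule indep_sets_mono_index[rotated]) auto
  then have ind: "indep_sets (\<lambda>b. sigma_sets (space M) (\<Union>j\<in>I \<times> {b}. G j)) UNIV"
    by (rule indep_sets_collect_sigma) (auto simp: GI disjoint_family_on_def)
  define \<Sigma> where "\<Sigma> b = sigma (space M) (\<Union>j\<in>I \<times> {b}. G j)" for b
  have "(\<Union>j\<in>I \<times> {b}. G j) \<subseteq> Pow (space M)" for b
  proof (rule UN_least)
    show "G j \<subseteq> Pow (space M)" if "j \<in> I \<times> {b}" for j
      using ev[of j] sets.space_closed[of M] that by auto
  qed
  then have sets_\<Sigma>: "sets (\<Sigma> b) = sigma_sets (space M) (\<Union>j\<in>I \<times> {b}. G j)" for b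
    unfolding \<Sigma>_def by (rule sets_measure_of)
  have space_\<Sigma>: "space (\<Sigma> b) = space M" for b
    by (simp add: \<Sigma>_def space_measure_of_conv)
  have mX: "(\<lambda>\<omega>. \<lambda>i\<in>I. X i \<omega>) \<in> measurable (\<Sigma> True) (PiM I (\<lambda>_. A))"
  proof (intro measurable_restrict measurableI)
    fix i assume i: "i \<in> I"
    show "X i \<omega> \<in> space A" if "\<omega> \<in> space (\<Sigma> True)" for \<omega>
      using that measurable_space[OF X[OF i]] by (simp add: space_\<Sigma>)
    show "X i -` E \<inter> space (\<Sigma> True) \<in> sets (\<Sigma> True)" if "E \<in> sets A" for E
      unfolding sets_\<Sigma> space_\<Sigma> using i that by (intro sigma_sets.Basic) (auto simp: G_simps)
  qed
  have mY: "(\<lambda>\<omega>. \<lambda>i\<in>I. Y i \<omega>) \<in> measurable (\<Sigma> False) (PiM I (\<lambda>_. B))"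
  proof (intro measurable_restrict measurableI)
    fix i assume i: "i \<in> I"
    show "Y i \<omega> \<in> space B" if "\<omega> \<in> space (\<Sigma> False)" for \<omega>
      using that measurable_space[OF Y[OF i]] by (simp add: space_\<Sigma>)
    show "Y i -` E \<inter> space (\<Sigma> False) \<in> sets (\<Sigma> False)" if "E \<in> sets B" for E
      unfolding sets_\<Sigma> space_\<Sigma> using i that by (intro sigma_sets.Basic) (auto simp: G_simps)
  qed
  have mX': "(\<lambda>\<omega>. \<lambda>i\<in>I. X i \<omega>) \<in> measurable M (PiM I (\<lambda>_. A))"
    using X by (intro measurable_restrict)
  have mY': "(\<lambda>\<omega>. \<lambda>i\<in>I. Y i \<omega>) \<in> measurable M (PiM I (\<lambda>_. B))"
    using Y by (intro measurable_restrict)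
  interpret DX: prob_space "distr M (PiM I (\<lambda>_. A)) (\<lambda>\<omega>. \<lambda>i\<in>I. X i \<omega>)"
    using mX' by (rule prob_space_distr)
  interpret DY: prob_space "distr M (PiM I (\<lambda>_. B)) (\<lambda>\<omega>. \<lambda>i\<in>I. Y i \<omega>)"
    using mY' by (rule prob_space_distr)
  show ?thesis
  proof (rule pair_measure_eqI[symmetric, OF DX.sigma_finite_measure_axioms DY.sigma_finite_measure_axioms])
    fix E F
    assume "E \<in> sets (distr M (PiM I (\<lambda>_. A)) (\<lambda>\<omega>. \<lambda>i\<in>I. X i \<omega>))"
      and "F \<in> sets (distr M (PiM I (\<lambda>_. B)) (\<lambda>\<omega>. \<lambda>i\<in>I. Y i \<omega>))"
    then have E: "E \<in> sets (PiM I (\<lambda>_. A))" and F: "F \<in> sets (PiM I (\<lambda>_. B))"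
      by auto
    let ?E = "(\<lambda>\<omega>. \<lambda>i\<in>I. X i \<omega>) -` E \<inter> space M" and ?F = "(\<lambda>\<omega>. \<lambda>i\<in>I. Y i \<omega>) -` F \<inter> space M"
    have "?E \<in> sigma_sets (space M) (\<Union>j\<in>I \<times> {True}. G j)"
        "?F \<in> sigma_sets (space M) (\<Union>j\<in>I \<times> {False}. G j)"
      using measurable_sets[OF mX E] measurable_sets[OF mY F] by (simp_all add: sets_\<Sigma> space_\<Sigma>)
    then have "prob (\<Inter>b\<in>UNIV. case_bool ?E ?F b) = (\<Prod>b\<in>UNIV. prob (case_bool ?E ?F b))"
      by (intro indep_setsD[OF ind]) (auto split: bool.split)
    then have "prob (?E \<inter> ?F) = prob ?E * prob ?F"
      by (simp add: UNIV_bool ac_simps)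
    moreover have "(\<lambda>\<omega>. (\<lambda>i\<in>I. X i \<omega>, \<lambda>i\<in>I. Y i \<omega>)) -` (E \<times> F) \<inter> space M = ?E \<inter> ?F"
      by auto
    ultimately show "emeasure (distr M (PiM I (\<lambda>_. A)) (\<lambda>\<omega>. \<lambda>i\<in>I. X i \<omega>)) E
          * emeasure (distr M (PiM I (\<lambda>_. B)) (\<lambda>\<omega>. \<lambda>i\<in>I. Y i \<omega>)) F
        = emeasure (distr M (PiM I (\<lambda>_. A) \<Otimes>\<^sub>M PiM I (\<lambda>_. B)) (\<lambda>\<omega>. (\<lambda>i\<in>I. X i \<omega>, \<lambda>i\<in>I. Y i \<omega>))) (E \<times> F)"
      using E F mX' mY'
      by (simp add: emeasure_distr emeasure_eq_measure ennreal_mult pair_measureI)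
  qed simp
qed

lemma borel_measurable_est_G:
  fixes x :: "'w \<Rightarrow> nat \<Rightarrow> 'a::metric_space"
  assumes "compact (UNIV :: 'a set)"
    and x: "\<And>i. i \<in> {1..N0 + N1} \<Longrightarrow> (\<lambda>w. x w i) \<in> borel_measurable M"
    and k: "k \<in> {1..N0}" and i: "i \<in> {1..N1}"
  shows "(\<lambda>w. est_G N0 N1 \<beta> q (x w) i k) \<in> borel_measurable M"
proof -
  have H: "(\<lambda>w. est_H N0 \<beta> (x w) l k) \<in> measurable M (count_space UNIV)" if "l \<in> {1..N1}" for l
  proof -
    have [measurable]: "(\<lambda>w. dist (x w (N0 + l)) (x w k)) \<in> borel_measurable M"
      using that k by (intro borel_measurable_dist_compact[OF assms(1)] x) auto
    show ?thesis
      unfolding est_H_def of_bool_def by measurable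
  qed
  have sums: "(\<lambda>w. \<Sum>l=1..j. est_H N0 \<beta> (x w) l k) \<in> measurable M (count_space UNIV)" if "j \<le> N1" for j
    using that by (intro measurable_sum_nat H) auto
  note [measurable] = H[OF i] sums[OF order_refl]
  have [measurable]: "(\<lambda>w. \<Sum>l=1..i. est_H N0 \<beta> (x w) l k) \<in> measurable M (count_space UNIV)"
    using i by (intro sums) auto
  show ?thesis
    unfolding est_G_def of_bool_def by measurable
qed

lemma measurable_count_est_H:
  fixes x :: "'w \<Rightarrow> nat \<Rightarrow> 'a::metric_space"
  assumes "compact (UNIV :: 'a set)"
    and x: "\<And>i. i \<in> {1..N0 + N1} \<Longrightarrow> (\<lambda>w. x w i) \<in> borel_measurable M"
    and k: "k \<in> {1..N0}"
  shows "(\<lambda>w. \<Sum>l=1..N1. est_H N0 \<beta> (x w) l k) \<in> measurable M (count_space UNIV)"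
proof (rule measurable_sum_nat)
  fix l assume "l \<in> {1..N1}"
  then have [measurable]: "(\<lambda>w. dist (x w (N0 + l)) (x w k)) \<in> borel_measurable M"
    using k by (intro borel_measurable_dist_compact[OF assms(1)] x) auto
  show "(\<lambda>w. est_H N0 \<beta> (x w) l k) \<in> measurable M (count_space UNIV)"
    unfolding est_H_def of_bool_def by measurable
qed

section \<open>The error bound\<close>

lemma sum_shift_block:
  "(\<Sum>n\<in>{N0 + 1..N0 + N1}. g n) = (\<Sum>i=1..N1. g (N0 + i :: nat))"
  using sum.shift_bounds_cl_nat_ivl[of g 1 N0 N1] by (simp add: ac_simps)

lemma exp_minus_le_inverse:
  fixes y z :: real
  assumes "0 < y" "ln y \<le> z"
  shows "exp (- z) \<le> 1 / y"
proof -
  have "exp (- z) \<le> exp (- ln y)" using assms(2) by simp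
  also have "\<dots> = 1 / y" using assms(1) by (simp add: exp_minus inverse_eq_divide)
  finally show ?thesis .
qed

theorem theorem3p2:
  fixes \<mu> :: "('a::metric_space \<times> real) measure"
    and \<mu>X :: "'a measure"
    and \<nu> :: "real measure"
    and P :: "'w measure"
    and X :: "nat \<Rightarrow> 'w \<Rightarrow> 'a"
    and \<xi> :: "nat \<Rightarrow> 'w \<Rightarrow> real"
    and f :: "'a \<Rightarrow> real"
    and fhat :: "'w \<Rightarrow> 'a \<Rightarrow> real"
    and a s C \<epsilon> \<delta> :: real
    and N0 N1 q :: nat
  assumes compact: "compact (UNIV :: 'a set)"
    and mu_prob: "prob_space \<mu>"
    and mu_borel: "sets \<mu> = sets borel"
    and muX_def: "\<mu>X = distr \<mu> borel fst"
    and nu_def: "\<nu> = distr \<mu> borel snd"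
    and P_prob: "prob_space P"
    and indep: "prob_space.indep_vars P (\<lambda>_. borel) (\<lambda>n \<omega>. (X n \<omega>, \<xi> n \<omega>)) {1..}"
    and law: "\<And>n. n \<ge> 1 \<Longrightarrow> distr P borel (\<lambda>\<omega>. (X n \<omega>, \<xi> n \<omega>)) = \<mu>"
    and a_pos: "a > 0" and s_pos: "s > 0" and C_pos: "C > 0"
    and supp: "measure_support \<mu>X = UNIV"
    and lower_regular:
      "\<And>x r. 0 < r \<Longrightarrow> r \<le> diameter (UNIV :: 'a set) \<Longrightarrow> measure \<mu>X (ball x r) \<ge> a * r powr s"
    and nu_integrable: "integrable \<nu> (\<lambda>t. t)"
    and nu_centred: "(\<integral>t. t \<partial>\<nu>) = 0"
    and nu_lsi: "log_sobolev C \<nu>"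
    and design_noise_indep: "\<mu> = \<mu>X \<Otimes>\<^sub>M \<nu>"
    and N0_pos: "N0 \<ge> 1" and N1_pos: "N1 \<ge> 1"
    and eps: "0 < \<epsilon>" "\<epsilon> < 1" and delta: "0 < \<delta>" "\<delta> < 1"
    and eps_diam: "\<epsilon> / 2 \<le> diameter (UNIV :: 'a set)"
    and q_def: "q = nat \<lceil>1 / \<epsilon>\<^sup>2\<rceil>"
    and N0_ge: "real N0 \<ge> 1 / (a * (\<epsilon> / 8) powr s)
                  * ln (4 * real (covering_number (UNIV :: 'a set) (\<epsilon> / 8)) / \<delta>)"
    and N1_ge: "real N1 \<ge> 1 / (a * (\<epsilon> / 2) powr s)
                  * max (2 * real q) (8 * ln (4 * real N0 / \<delta>))"
    and f_lip: "1-lipschitz_on UNIV f"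
    and fhat_def: "\<And>\<omega>. fhat \<omega> = estimator N0 N1 (\<epsilon> / 2) q 1
                          (\<lambda>n. X n \<omega>) (\<lambda>n. f (X n \<omega>) + \<xi> n \<omega>)"
  shows "(\<forall>\<omega>\<in>space P. 1-lipschitz_on UNIV (fhat \<omega>))
       \<and> measure P {\<omega> \<in> space P. sup_norm (\<lambda>x. fhat \<omega> x - f x)
                        \<le> \<epsilon> * (1 + sqrt (C * ln (4 * real N0 / \<delta>)))} \<ge> 1 - \<delta>"
proof -

  \<comment> \<open>Marginal laws, independence and exponential moments of the observations\<close>
  interpret P: prob_space P by (rule P_prob)
  interpret \<mu>: prob_space \<mu> by (rule mu_prob)
  have fst_m: "fst \<in> borel_measurable (borel :: ('a \<times> real) measure)"
      and snd_m: "snd \<in> borel_measurable (borel :: ('a \<times> real) measure)"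
    by (intro borel_measurable_continuous_onI continuous_intros)+
  have fst_mu: "fst \<in> borel_measurable \<mu>" and snd_mu: "snd \<in> borel_measurable \<mu>"
    using fst_m snd_m measurable_cong_sets[OF mu_borel refl] by blast+
  interpret \<mu>X: prob_space \<mu>X
    unfolding muX_def by (rule \<mu>.prob_space_distr[OF fst_mu])
  interpret \<nu>: prob_space \<nu>
    unfolding nu_def by (rule \<mu>.prob_space_distr[OF snd_mu])
  have sets_muX[simp]: "sets \<mu>X = sets borel" and sets_nu[simp]: "sets \<nu> = sets borel"
    by (simp_all add: muX_def nu_def)
  have Z: "(\<lambda>\<omega>. (X n \<omega>, \<xi> n \<omega>)) \<in> borel_measurable P" if "1 \<le> n" for n
    using indep that by (auto simp: P.indep_vars_def)
  have Xm: "X n \<in> borel_measurable P" if "1 \<le> n" for n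
    using measurable_compose[OF Z[OF that] fst_m] by simp
  have \<xi>m: "\<xi> n \<in> borel_measurable P" if "1 \<le> n" for n
    using measurable_compose[OF Z[OF that] snd_m] by simp
  have distrX: "distr P borel (X n) = \<mu>X" if "1 \<le> n" for n
    unfolding muX_def law[OF that, symmetric] using fst_m Z[OF that]
    by (subst distr_distr) (simp_all add: comp_def)
  have distr\<xi>: "distr P borel (\<xi> n) = \<nu>" if "1 \<le> n" for n
    unfolding nu_def law[OF that, symmetric] using snd_m Z[OF that]
    by (subst distr_distr) (simp_all add: comp_def)
  have prX: "P.prob {\<omega> \<in> space P. X n \<omega> \<in> E} = measure \<mu>X E" if "1 \<le> n" "E \<in> sets borel" for n E
    unfolding distrX[OF that(1), symmetric] using Xm[OF that(1)] that(2)
    by (subst measure_distr) (auto intro!: arg_cong[where f = P.prob])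
  have pr\<xi>: "P.prob {\<omega> \<in> space P. \<xi> n \<omega> \<in> E} = measure \<nu> E" if "1 \<le> n" "E \<in> sets borel" for n E
    unfolding distr\<xi>[OF that(1), symmetric] using \<xi>m[OF that(1)] that(2)
    by (subst measure_distr) (auto intro!: arg_cong[where f = P.prob])
  \<comment> \<open>Equality of measures includes equality of their sigma-algebras, so
    \<open>design_noise_indep\<close> places measurable rectangles among the Borel sets of the
    product type.\<close>
  have rect: "E \<times> F \<in> sets (borel :: ('a \<times> real) measure)"
    if "E \<in> sets borel" "F \<in> sets borel" for E :: "'a set" and F :: "real set"
  proof -
    have "E \<times> F \<in> sets (\<mu>X \<Otimes>\<^sub>M \<nu>)"
      using that by (intro pair_measureI) auto
    then show ?thesis
      unfolding design_noise_indep[symmetric] mu_borel .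
  qed
  have prX\<xi>: "P.prob {\<omega> \<in> space P. X n \<omega> \<in> E \<and> \<xi> n \<omega> \<in> F}
      = P.prob {\<omega> \<in> space P. X n \<omega> \<in> E} * P.prob {\<omega> \<in> space P. \<xi> n \<omega> \<in> F}"
    if n: "1 \<le> n" and E: "E \<in> sets borel" and F: "F \<in> sets borel" for n E F
  proof -
    have "P.prob {\<omega> \<in> space P. X n \<omega> \<in> E \<and> \<xi> n \<omega> \<in> F} = measure \<mu> (E \<times> F)"
      unfolding law[OF n, symmetric] using Z[OF n] rect[OF E F]
      by (subst measure_distr) (auto intro!: arg_cong[where f = P.prob])
    also have "\<dots> = measure \<mu>X E * measure \<nu> F"
      using \<nu>.emeasure_pair_measure_Times[of E \<mu>X F] E F
      by (subst design_noise_indep) (simp add: measure_def enn2real_mult)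
    finally show ?thesis
      by (simp add: prX[OF n E] pr\<xi>[OF n F])
  qed
  have indepX: "P.indep_vars (\<lambda>_. borel) X {1..}"
    using P.indep_vars_compose2[OF indep, of "\<lambda>_. fst" "\<lambda>_. borel"] fst_m by simp
  have indep\<xi>: "P.indep_vars (\<lambda>_. borel) \<xi> {1..}"
    using P.indep_vars_compose2[OF indep, of "\<lambda>_. snd" "\<lambda>_. borel"] snd_m by simp
  have mgf: "integrable P (\<lambda>\<omega>. exp (l * \<xi> n \<omega>))"
      "P.expectation (\<lambda>\<omega>. exp (l * \<xi> n \<omega>)) \<le> exp (C * l\<^sup>2 / 4)" if "1 \<le> n" for n l
  proof -
    have em: "(\<lambda>t. exp (l * t)) \<in> borel_measurable (borel :: real measure)"
      by measurable
    note m = log_sobolev_mgf[OF \<nu>.prob_space_axioms sets_nu nu_lsi less_imp_le[OF C_pos]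
        nu_integrable nu_centred, of l]
    show "integrable P (\<lambda>\<omega>. exp (l * \<xi> n \<omega>))"
      using m(1) unfolding distr\<xi>[OF that, symmetric] integrable_distr_eq[OF \<xi>m[OF that] em] .
    show "P.expectation (\<lambda>\<omega>. exp (l * \<xi> n \<omega>)) \<le> exp (C * l\<^sup>2 / 4)"
      using m(2) unfolding distr\<xi>[OF that, symmetric] integral_distr[OF \<xi>m[OF that] em] .
  qed

  \<comment> \<open>Constants and bad events\<close>
  define \<Lambda> where "\<Lambda> = ln (4 * real N0 / \<delta>)"
  have big: "1 < 4 * real N0 / \<delta>"
    using N0_pos delta by (simp add: less_divide_eq)
  have \<Lambda>: "0 < \<Lambda>"
    unfolding \<Lambda>_def using big by (rule ln_gt_zero)
  define t where "t = \<epsilon> * sqrt (C * \<Lambda>)"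
  have t: "0 < t" using eps C_pos \<Lambda> by (simp add: t_def)
  have q_ge: "1 / \<epsilon>\<^sup>2 \<le> real q"
    unfolding q_def by (rule real_nat_ceiling_ge)
  have q: "1 \<le> q"
  proof -
    have "0 < 1 / \<epsilon>\<^sup>2" using eps by simp
    then have "0 < real q" using q_ge by linarith
    then show ?thesis by simp
  qed
  define J where "J = {N0 + 1..N0 + N1}"
  have cardJ: "card J = N1" and finJ: "finite J" and J1: "\<And>n. n \<in> J \<Longrightarrow> 1 \<le> n"
    by (auto simp: J_def)
  have indepXJ: "P.indep_vars (\<lambda>_. borel) X J" and indep\<xi>J: "P.indep_vars (\<lambda>_. borel) \<xi> J"
    by (rule P.indep_vars_subset[OF indepX] P.indep_vars_subset[OF indep\<xi>], use J1 in auto)+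

  define B1 where "B1 c = {\<omega> \<in> space P. \<forall>k\<in>{1..N0}. X k \<omega> \<notin> ball c (\<epsilon> / 8)}" for c
  define B2 where "B2 k = {\<omega> \<in> space P. (\<Sum>l=1..N1. est_H N0 (\<epsilon> / 2) (\<lambda>n. X n \<omega>) l k) < q}" for k
  define B3 where "B3 k = {\<omega> \<in> space P. t < \<bar>\<Sum>i=1..N1. \<xi> (N0 + i) \<omega> * est_G N0 N1 (\<epsilon> / 2) q (\<lambda>n. X n \<omega>) i k\<bar>}" for k

  have e8: "0 < \<epsilon> / 8" using eps by simp
  obtain A :: "'a set" where A: "finite A" "UNIV \<subseteq> (\<Union>x\<in>A. ball x (\<epsilon> / 8))"
      "card A = covering_number (UNIV :: 'a set) (\<epsilon> / 8)"
    by (rule covering_number_attained[OF compact e8])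
  have cardA: "0 < card A"
    using A(1,2) by (auto simp: card_gt_0_iff)

  \<comment> \<open>Probabilities of the bad events\<close>
  have B1_le: "P.prob (B1 c) \<le> \<delta> / (4 * real (card A))" for c
  proof -
    let ?p = "a * (\<epsilon> / 8) powr s"
    have p: "0 < ?p" using a_pos eps by simp
    have "P.prob (B1 c) \<le> exp (- (real (card {1..N0}) * ?p))"
      unfolding B1_def
    proof (rule P.prob_all_miss_le[where N = borel])
      show "P.indep_vars (\<lambda>_. borel) X {1..N0}"
        by (rule P.indep_vars_subset[OF indepX]) auto
      show "?p \<le> P.prob {\<omega> \<in> space P. X i \<omega> \<in> ball c (\<epsilon> / 8)}" if "i \<in> {1..N0}" for i
        using that lower_regular[of "\<epsilon> / 8" c] eps eps_diam by (subst prX) auto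
    qed (use N0_pos in auto)
    also have "\<dots> \<le> 1 / (4 * real (card A) / \<delta>)"
    proof (rule exp_minus_le_inverse)
      show "0 < 4 * real (card A) / \<delta>"
        using cardA delta by simp
      show "ln (4 * real (card A) / \<delta>) \<le> real (card {1..N0}) * ?p"
        using N0_ge p by (simp add: A(3) field_simps)
    qed
    finally show ?thesis by simp
  qed

  have B2_le: "P.prob (B2 k) \<le> \<delta> / (4 * real N0)" if k: "k \<in> {1..N0}" for k
  proof -
    let ?p = "a * (\<epsilon> / 2) powr s"
    have p: "0 < ?p" using a_pos eps by simp
    \<comment> \<open>The first entry of the maximum is the requirement on the threshold
      \<open>q\<close> in the count bound; the second makes its exponent \<open>N1 * p / 8\<close>
      at least \<open>\<Lambda>\<close>.\<close>
    have N1p: "max (2 * real q) (8 * \<Lambda>) \<le> real N1 * ?p"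
      using N1_ge p unfolding \<Lambda>_def by (simp only: times_divide_eq_left mult_1 pos_divide_le_eq)
    let ?U = "PiM {k} (\<lambda>_. borel :: 'a measure)" and ?V = "PiM J (\<lambda>_. borel :: 'a measure)"
    define S where "S = {w \<in> space (?U \<Otimes>\<^sub>M ?V).
        (\<Sum>l=1..N1. of_bool (dist (snd w (N0 + l)) (fst w k) \<le> \<epsilon> / 2) :: nat) < q}"
    have S: "S \<in> sets (?U \<Otimes>\<^sub>M ?V)"
    proof -
      have [measurable]: "(\<lambda>w. dist (snd w (N0 + l)) (fst w k)) \<in> borel_measurable (?U \<Otimes>\<^sub>M ?V)"
        if "l \<in> {1..N1}" for l
        using that by (intro borel_measurable_dist_compact[OF compact]
            measurable_compose[OF measurable_snd] measurable_compose[OF measurable_fst]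
            measurable_component_singleton) (auto simp: J_def)
      have [measurable]: "(\<lambda>w. \<Sum>l=1..N1. of_bool (dist (snd w (N0 + l)) (fst w k) \<le> \<epsilon> / 2) :: nat)
          \<in> measurable (?U \<Otimes>\<^sub>M ?V) (count_space UNIV)"
        unfolding of_bool_def by (intro measurable_sum_nat) measurable
      show ?thesis unfolding S_def by measurable
    qed
    have iv: "P.indep_var ?U (\<lambda>\<omega>. \<lambda>i\<in>{k}. X i \<omega>) ?V (\<lambda>\<omega>. \<lambda>i\<in>J. X i \<omega>)"
      using k J1 by (intro P.indep_var_restrict[OF indepX]) (auto simp: J_def)
    have "P.prob {\<omega> \<in> space P. (\<lambda>i\<in>{k}. X i \<omega>, \<lambda>i\<in>J. X i \<omega>) \<in> S} \<le> \<delta> / (4 * real N0)"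
    proof (rule P.prob_pair_le[OF _ _ _ S])
      fix y assume "y \<in> space ?U"
      have "{\<omega> \<in> space P. (y, \<lambda>i\<in>J. X i \<omega>) \<in> S}
          = {\<omega> \<in> space P. (\<Sum>i\<in>J. of_bool (X i \<omega> \<in> cball (y k) (\<epsilon> / 2))) < q}"
      proof -
        have "(\<Sum>l=1..N1. of_bool (dist ((\<lambda>i\<in>J. X i \<omega>) (N0 + l)) (y k) \<le> \<epsilon> / 2) :: nat)
            = (\<Sum>i\<in>J. of_bool (X i \<omega> \<in> cball (y k) (\<epsilon> / 2)))" for \<omega>
          unfolding J_def sum_shift_block by (intro sum.cong) (auto simp: dist_commute)
        then show ?thesis
          using \<open>y \<in> space ?U\<close> by (auto simp: S_def space_pair_measure space_PiM)
      qed
      also have "P.prob \<dots> \<le> exp (- (real (card J) * ?p / 8))"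
      proof (rule P.success_count_lower_tail[OF finJ indepXJ])
        fix i assume i: "i \<in> J"
        \<comment> \<open>Neighbours are counted in closed balls, while the mass bound is for open
          ones.\<close>
        have "?p \<le> measure \<mu>X (ball (y k) (\<epsilon> / 2))"
          using lower_regular[of "\<epsilon> / 2"] eps eps_diam by simp
        also have "\<dots> \<le> measure \<mu>X (cball (y k) (\<epsilon> / 2))"
          by (intro \<mu>X.finite_measure_mono) auto
        finally show "?p \<le> P.prob {\<omega> \<in> space P. X i \<omega> \<in> cball (y k) (\<epsilon> / 2)}"
          using J1[OF i] by (subst prX) auto
      qed (use N1p in \<open>auto simp: cardJ\<close>)
      also have "\<dots> \<le> 1 / (4 * real N0 / \<delta>)"
        using N1p big by (intro exp_minus_le_inverse) (auto simp: cardJ \<Lambda>_def)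
      finally show "P.prob {\<omega> \<in> space P. (y, \<lambda>i\<in>J. X i \<omega>) \<in> S} \<le> \<delta> / (4 * real N0)"
        by simp
    qed (use iv P.indep_var_distribution_eq[of ?U _ ?V] in auto)
    also have "{\<omega> \<in> space P. (\<lambda>i\<in>{k}. X i \<omega>, \<lambda>i\<in>J. X i \<omega>) \<in> S} = B2 k"
    proof -
      have "(\<Sum>l=1..N1. of_bool (dist ((\<lambda>i\<in>J. X i \<omega>) (N0 + l)) ((\<lambda>i\<in>{k}. X i \<omega>) k) \<le> \<epsilon> / 2) :: nat)
          = (\<Sum>l=1..N1. est_H N0 (\<epsilon> / 2) (\<lambda>n. X n \<omega>) l k)" for \<omega>
        by (intro sum.cong) (auto simp: est_H_def J_def)
      then show ?thesis
        by (auto simp: S_def B2_def space_pair_measure space_PiM)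
    qed
    finally show ?thesis .
  qed

  have B3_le: "P.prob (B3 k) \<le> \<delta> / (2 * real N0)" if k: "k \<in> {1..N0}" for k
  proof -
    define I where "I = {1..N0 + N1}"
    let ?U = "PiM I (\<lambda>_. borel :: 'a measure)" and ?V = "PiM I (\<lambda>_. borel :: real measure)"
    define S where "S = {w \<in> space (?U \<Otimes>\<^sub>M ?V).
        t < \<bar>\<Sum>i=1..N1. snd w (N0 + i) * est_G N0 N1 (\<epsilon> / 2) q (fst w) i k\<bar>}"
    have S: "S \<in> sets (?U \<Otimes>\<^sub>M ?V)"
    proof -
      have "(\<lambda>w. est_G N0 N1 (\<epsilon> / 2) q (fst w) i k) \<in> borel_measurable (?U \<Otimes>\<^sub>M ?V)"
        if "i \<in> {1..N1}" for i
        using that by (intro borel_measurable_est_G[OF compact _ k] measurable_compose[OF measurable_fst]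
            measurable_component_singleton) (auto simp: I_def)
      moreover have "(\<lambda>w. snd w (N0 + i)) \<in> borel_measurable (?U \<Otimes>\<^sub>M ?V)" if "i \<in> {1..N1}" for i
        using that by (intro measurable_compose[OF measurable_snd] measurable_component_singleton)
          (auto simp: I_def)
      ultimately have [measurable]: "(\<lambda>w. \<Sum>i=1..N1. snd w (N0 + i) * est_G N0 N1 (\<epsilon> / 2) q (fst w) i k)
          \<in> borel_measurable (?U \<Otimes>\<^sub>M ?V)"
        by (intro borel_measurable_sum borel_measurable_times)
      show ?thesis unfolding S_def by measurable
    qed
    have I1: "1 \<le> n" if "n \<in> I" for n
      using that by (simp add: I_def)
    have "P.prob {\<omega> \<in> space P. (\<lambda>i\<in>I. X i \<omega>, \<lambda>i\<in>I. \<xi> i \<omega>) \<in> S} \<le> \<delta> / (2 * real N0)"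
    proof (rule P.prob_pair_le[OF _ _ _ S])
      show "(\<lambda>\<omega>. \<lambda>i\<in>I. X i \<omega>) \<in> measurable P ?U" "(\<lambda>\<omega>. \<lambda>i\<in>I. \<xi> i \<omega>) \<in> measurable P ?V"
        by (intro measurable_restrict Xm \<xi>m I1; assumption)+
      show "distr P (?U \<Otimes>\<^sub>M ?V) (\<lambda>\<omega>. (\<lambda>i\<in>I. X i \<omega>, \<lambda>i\<in>I. \<xi> i \<omega>))
          = distr P ?U (\<lambda>\<omega>. \<lambda>i\<in>I. X i \<omega>) \<Otimes>\<^sub>M distr P ?V (\<lambda>\<omega>. \<lambda>i\<in>I. \<xi> i \<omega>)"
      proof (rule P.distr_restrict_pair)
        show "P.indep_vars (\<lambda>_. borel) (\<lambda>i \<omega>. (X i \<omega>, \<xi> i \<omega>)) I"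
          by (rule P.indep_vars_subset[OF indep]) (auto simp: I_def)
      qed (use N0_pos I1 in \<open>auto simp: I_def intro: Xm \<xi>m rect prX\<xi>\<close>)
      fix y assume y: "y \<in> space ?U"
      \<comment> \<open>The noise variables keep their sample index \<open>n\<close> in the
        averaging block, so the weight of \<open>n\<close> is the one with block index
        \<open>n - N0\<close>.\<close>
      let ?w = "\<lambda>n. est_G N0 N1 (\<epsilon> / 2) q y (n - N0) k"
      have "{\<omega> \<in> space P. (y, \<lambda>i\<in>I. \<xi> i \<omega>) \<in> S} = {\<omega> \<in> space P. t < \<bar>\<Sum>n\<in>J. \<xi> n \<omega> * ?w n\<bar>}"
      proof -
        have "(\<Sum>i=1..N1. (\<lambda>i\<in>I. \<xi> i \<omega>) (N0 + i) * est_G N0 N1 (\<epsilon> / 2) q y i k) = (\<Sum>n\<in>J. \<xi> n \<omega> * ?w n)" for \<omega>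
          unfolding J_def sum_shift_block by (intro sum.cong) (auto simp: I_def)
        then show ?thesis
          using y by (auto simp: S_def space_pair_measure space_PiM)
      qed
      also have "P.prob \<dots> \<le> 2 * exp (- (t\<^sup>2 / (C * (1 / real q))))"
      proof (rule P.subgaussian_weighted_tail_abs[OF finJ indep\<xi>J _ _ _ C_pos _ t])
        show "(\<Sum>n\<in>J. (?w n)\<^sup>2) \<le> 1 / real q"
          unfolding J_def sum_shift_block using sum_est_G_square_le[OF q] by simp
      qed (use mgf J1 q in auto)
      also have "\<dots> \<le> 2 * (1 / (4 * real N0 / \<delta>))"
      proof (intro mult_left_mono exp_minus_le_inverse)
        \<comment> \<open>The choice of \<open>q\<close> enters here:
          \<open>\<epsilon>\<^sup>2 * q\<close> is at least \<open>1\<close>, so the exponent is at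
          least \<open>\<Lambda>\<close>.\<close>
        have "t\<^sup>2 / (C * (1 / real q)) = \<epsilon>\<^sup>2 * real q * \<Lambda>"
          using C_pos \<Lambda> q by (simp add: t_def power_mult_distrib field_simps)
        moreover have "1 * \<Lambda> \<le> \<epsilon>\<^sup>2 * real q * \<Lambda>"
          using q_ge eps \<Lambda> by (intro mult_right_mono) (auto simp: field_simps)
        ultimately show "ln (4 * real N0 / \<delta>) \<le> t\<^sup>2 / (C * (1 / real q))"
          by (simp add: \<Lambda>_def)
      qed (use big in auto)
      finally show "P.prob {\<omega> \<in> space P. (y, \<lambda>i\<in>I. \<xi> i \<omega>) \<in> S} \<le> \<delta> / (2 * real N0)"
        by simp
    qed
    also have "{\<omega> \<in> space P. (\<lambda>i\<in>I. X i \<omega>, \<lambda>i\<in>I. \<xi> i \<omega>) \<in> S} = B3 k"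
    proof -
      have "(\<Sum>i=1..N1. (\<lambda>i\<in>I. \<xi> i \<omega>) (N0 + i) * est_G N0 N1 (\<epsilon> / 2) q (\<lambda>i\<in>I. X i \<omega>) i k)
          = (\<Sum>i=1..N1. \<xi> (N0 + i) \<omega> * est_G N0 N1 (\<epsilon> / 2) q (\<lambda>n. X n \<omega>) i k)" for \<omega>
        using k by (intro sum.cong refl arg_cong2[where f = "(*)"] est_G_cong) (auto simp: I_def)
      then show ?thesis
        by (auto simp: S_def B3_def space_pair_measure space_PiM)
    qed
    finally show ?thesis .
  qed

  \<comment> \<open>Lipschitz property and measurability\<close>
  have lip_fhat: "1-lipschitz_on UNIV (fhat \<omega>)" for \<omega>
    unfolding fhat_def using N0_pos by (intro lipschitz_on_estimator) auto

  have Xm': "(\<lambda>\<omega>. X i \<omega>) \<in> borel_measurable P" if "i \<in> {1..N0 + N1}" for i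
    using that Xm by simp
  have Gm: "(\<lambda>\<omega>. est_G N0 N1 (\<epsilon> / 2) q (\<lambda>n. X n \<omega>) i k) \<in> borel_measurable P"
    if "k \<in> {1..N0}" "i \<in> {1..N1}" for k i
    using that by (intro borel_measurable_est_G[OF compact Xm'])
  have B1m: "B1 c \<in> P.events" for c
    unfolding B1_def
  proof (intro sets.sets_Collect_finite_All' sets.sets_Collect_neg)
    show "{\<omega> \<in> space P. X k \<omega> \<in> ball c (\<epsilon> / 8)} \<in> P.events" if "k \<in> {1..N0}" for k
      using measurable_sets[OF Xm, of k "ball c (\<epsilon> / 8)"] that
      by (simp add: vimage_def Int_def conj_commute)
  qed (use N0_pos in auto)
  have B2m: "B2 k \<in> P.events" if "k \<in> {1..N0}" for k
  proof -
    note [measurable] = measurable_count_est_H[OF compact Xm' that, where \<beta> = "\<epsilon> / 2"]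
    show ?thesis unfolding B2_def by measurable
  qed
  have B3m: "B3 k \<in> P.events" if "k \<in> {1..N0}" for k
  proof -
    have [measurable]: "(\<lambda>\<omega>. \<Sum>i=1..N1. \<xi> (N0 + i) \<omega> * est_G N0 N1 (\<epsilon> / 2) q (\<lambda>n. X n \<omega>) i k)
        \<in> borel_measurable P"
      by (intro borel_measurable_sum borel_measurable_times \<xi>m Gm that) auto
    show ?thesis unfolding B3_def by measurable
  qed

  define r where "r = \<epsilon> * (1 + sqrt (C * \<Lambda>))"
  define good where "good = {\<omega> \<in> space P. sup_norm (\<lambda>x. fhat \<omega> x - f x) \<le> r}"
  have cont: "continuous_on UNIV (\<lambda>x. \<bar>fhat \<omega> x - f x\<bar>)" for \<omega>
    using lipschitz_on_continuous_on[OF lip_fhat] lipschitz_on_continuous_on[OF f_lip]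
    by (intro continuous_intros)
  have "bdd_above (range (\<lambda>x. \<bar>fhat \<omega> x - f x\<bar>))" for \<omega>
    by (intro bounded_imp_bdd_above compact_imp_bounded compact_continuous_image cont compact)
  then have good_iff: "sup_norm (\<lambda>x. fhat \<omega> x - f x) \<le> r \<longleftrightarrow> (\<forall>x. \<bar>fhat \<omega> x - f x\<bar> \<le> r)" for \<omega>
    by (rule sup_norm_le_iff)
  \<comment> \<open>Needed for passing to the complement: \<open>measure\<close> would be
    \<open>0\<close> on a nonmeasurable set. Continuity of the error reduces the condition to a
    countable dense set.\<close>
  have good_m: "good \<in> P.events"
  proof -
    obtain D :: "'a set" where D: "countable D" "closure D = UNIV"
      using compact_countable_dense[OF compact] .
    have f_m: "f \<in> borel_measurable borel"
      by (intro borel_measurable_continuous_onI lipschitz_on_continuous_on[OF f_lip])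
    have Vm: "(\<lambda>\<omega>. est_V N0 N1 (\<epsilon> / 2) q (\<lambda>n. X n \<omega>) (\<lambda>n. f (X n \<omega>) + \<xi> n \<omega>) k) \<in> borel_measurable P"
      if "k \<in> {1..N0}" for k
      unfolding est_V_def
      by (intro borel_measurable_sum borel_measurable_times borel_measurable_add \<xi>m Gm that
          measurable_compose[OF Xm f_m]) auto
    have dm: "(\<lambda>\<omega>. dist d (X k \<omega>)) \<in> borel_measurable P" if "k \<in> {1..N0}" for d k
      using that by (intro borel_measurable_dist_compact[OF compact] Xm) auto
    have fhat_m: "(\<lambda>\<omega>. fhat \<omega> d) \<in> borel_measurable P" for d
      unfolding fhat_def estimator_def
      by (intro borel_measurable_times borel_measurable_add borel_measurable_diff borel_measurable_const
          borel_measurable_Min borel_measurable_Max Vm dm) auto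
    have "good = {\<omega> \<in> space P. \<forall>d\<in>D. \<bar>fhat \<omega> d - f d\<bar> \<le> r}"
      unfolding good_def good_iff using closure_le_continuous[OF D(2) cont] by blast
    also have "\<dots> \<in> P.events"
    proof (intro sets.sets_Collect_countable_All' D(1))
      fix d
      note [measurable] = fhat_m[of d]
      show "{\<omega> \<in> space P. \<bar>fhat \<omega> d - f d\<bar> \<le> r} \<in> P.events"
        by measurable
    qed
    finally show ?thesis .
  qed

  \<comment> \<open>Union bound\<close>
  have cover: "space P - good \<subseteq> (\<Union>c\<in>A. B1 c) \<union> ((\<Union>k\<in>{1..N0}. B2 k) \<union> (\<Union>k\<in>{1..N0}. B3 k))"
  proof (rule subsetI, rule ccontr)
    fix \<omega> assume \<omega>: "\<omega> \<in> space P - good"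
      and "\<omega> \<notin> (\<Union>c\<in>A. B1 c) \<union> ((\<Union>k\<in>{1..N0}. B2 k) \<union> (\<Union>k\<in>{1..N0}. B3 k))"
    then have n1: "\<And>c. c \<in> A \<Longrightarrow> \<exists>k\<in>{1..N0}. X k \<omega> \<in> ball c (\<epsilon> / 8)"
      and n2: "\<And>k. k \<in> {1..N0} \<Longrightarrow> q \<le> (\<Sum>l=1..N1. est_H N0 (\<epsilon> / 2) (\<lambda>n. X n \<omega>) l k)"
      and n3: "\<And>k. k \<in> {1..N0} \<Longrightarrow>
        \<bar>\<Sum>i=1..N1. \<xi> (N0 + i) \<omega> * est_G N0 N1 (\<epsilon> / 2) q (\<lambda>n. X n \<omega>) i k\<bar> \<le> t"
      unfolding B1_def B2_def B3_def by (blast, force simp: not_less, force simp: not_less)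
    have "\<bar>fhat \<omega> z - f z\<bar> \<le> r" for z
    proof -
      obtain c where c: "c \<in> A" "z \<in> ball c (\<epsilon> / 8)"
        using A(2) by blast
      obtain k where k: "k \<in> {1..N0}" "X k \<omega> \<in> ball c (\<epsilon> / 8)"
        using n1[OF c(1)] by blast
      \<comment> \<open>Two radii \<open>\<epsilon> / 8\<close> give \<open>\<epsilon> / 4\<close>;
        the weaker \<open>\<epsilon> / 2\<close> already suffices, since with the bias
        \<open>\<epsilon> / 2\<close> it adds up to \<open>\<epsilon>\<close>.\<close>
      have "dist z (X k \<omega>) \<le> \<epsilon> / 2"
        using c(2) k(2) dist_triangle[of z "X k \<omega>" c] eps(1) by (simp add: dist_commute)
      then have "\<bar>fhat \<omega> z - f z\<bar> \<le> \<epsilon> / 2 + \<epsilon> / 2 + t"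
        unfolding fhat_def using k(1) by (intro estimator_error[OF f_lip q n2 n3]) auto
      also have "\<dots> = r"
        by (simp add: r_def t_def algebra_simps)
      finally show ?thesis .
    qed
    then show False
      using \<omega> by (simp add: good_def good_iff)
  qed
  have "P.prob (space P - good)
      \<le> P.prob ((\<Union>c\<in>A. B1 c) \<union> ((\<Union>k\<in>{1..N0}. B2 k) \<union> (\<Union>k\<in>{1..N0}. B3 k)))"
    by (intro P.finite_measure_mono cover sets.Un sets.finite_UN A(1) B1m B2m B3m) auto
  also have "\<dots> \<le> P.prob (\<Union>c\<in>A. B1 c) + (P.prob (\<Union>k\<in>{1..N0}. B2 k) + P.prob (\<Union>k\<in>{1..N0}. B3 k))"
    by (intro order_trans[OF measure_Un_le] add_mono order_refl measure_Un_le sets.Un sets.finite_UN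
        A(1) B1m B2m B3m) auto
  also have "P.prob (\<Union>c\<in>A. B1 c) \<le> (\<Sum>c\<in>A. \<delta> / (4 * real (card A)))"
    using A(1) B1m by (intro order_trans[OF P.finite_measure_subadditive_finite] sum_mono B1_le) auto
  also have "\<dots> = \<delta> / 4"
    using cardA by simp
  also have "P.prob (\<Union>k\<in>{1..N0}. B2 k) \<le> (\<Sum>k\<in>{1..N0}. \<delta> / (4 * real N0))"
    using B2m by (intro order_trans[OF P.finite_measure_subadditive_finite] sum_mono B2_le) auto
  also have "\<dots> = \<delta> / 4"
    using N0_pos by simp
  also have "P.prob (\<Union>k\<in>{1..N0}. B3 k) \<le> (\<Sum>k\<in>{1..N0}. \<delta> / (2 * real N0))"
    using B3m by (intro order_trans[OF P.finite_measure_subadditive_finite] sum_mono B3_le) auto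
  also have "\<dots> = \<delta> / 2"
    using N0_pos by simp
  finally have "P.prob (space P - good) \<le> \<delta>"
    by simp
  then have "1 - \<delta> \<le> P.prob good"
    using P.prob_compl[OF good_m] by simp
  then show ?thesis
    using lip_fhat by (simp add: good_def r_def \<Lambda>_def)
qed

end
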